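(* Let $A$ be an ordered Banach algebra with a closed positive cone and a positive left approximate identity $\{e_\lambda\}_{\lambda\in\Lambda}$ of bound $M\geq 1$, let $X$ be an ordered Banach space with a closed positive cone, and let $\pi$ be a positive continuous representation of $A$ on $X$. Let $S$ be a non-empty subset of $X^+$ such that $\lim_\lambda\pi(e_\lambda)s=s$ uniformly on $S$, and suppose that $S$ is bounded or that $\{e_\lambda\}_{\lambda\in\Lambda}$ is commutative. Suppose that there exists a unital ordered Banach superalgebra $B\supset A$ such that: (i) the restricted positive continuous representation $\pi_{\mathrm e}$ of $A$ on the essential subspace $X_{\mathrm e}$ extends to a positive continuous unital representation (again denoted by $\pi_{\mathrm e}$) of $B$ on $X_{\mathrm e}$; (ii) $B^+$ is inverse closed in $B$, i.e. $b^{-1}\in B^+$ whenever $b\in B^+$ is invertible in $B$. Then, for every $\epsilon>0$, every $\delta>0$, every $r$ with $0<r<(M+1)^{-1}$, every integer $n_0\geq 1$, and every sequence $\{\alpha_n\}_{n=1}^\infty$ in $(1,\infty)$ with $\lim_{n\to\infty}\alpha_n=\infty$, there exists a simultaneous power factorization $(a,(x_n)_{n\geq 1})$ (in the sense defined in the context) for $\pi_{\mathrm e}$ on $Y=X_{\mathrm e}$, the set $T=S$, the superalgebra $B$ and the parameters $\epsilon,\delta,r,n_0,\{\alpha_n\}$, such that in addition: (8) $a\in A^+$; (9) $x_n(S)\subset X_{\mathrm e}^+$ for all $n\geq 1$.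
   Context: All algebras and vector spaces are over $\mathbb F=\mathbb R$ or $\mathbb C$. Unit elements of unital normed algebras have norm $1$. A left approximate identity of bound $M$ for $A$ is a net $\{e_\lambda\}$ in $A$ with $\|e_\lambda\|\leq M$ and $\lim_\lambda e_\lambda a=a$ for all $a\in A$; it is commutative if its elements commute pairwise, and positive if all $e_\lambda\in A^+$. A continuous representation on $X$ is a norm-continuous algebra homomorphism into the bounded operators on $X$; it is unital if it maps the unit to the identity operator. Uniform convergence $\lim_\lambda\pi(e_\lambda)s=s$ on $S$: for every $\eta>0$ there is $\lambda_0$ with $\|\pi(e_\lambda)s-s\|<\eta$ for all $\lambda\geq\lambda_0$, $s\in S$. Order conventions: an ordered vector space $X$ is a (real or complex) vector space with a positive convex cone $X^+$; an ordered algebra is an algebra with a positive convex algebra cone $A^+$ (closed under products). Cones need not be proper, generating or closed unless stated. The unit of a unital ordered algebra is positive. A representation $\pi$ of $A$ on $X$ is positive if $\pi(a)x\in X^+$ for $a\in A^+$, $x\in X^+$. A unital (ordered) Banach superalgebra $B$ of $A$ is a unital (ordered) Banach algebra containing $A$ as a closed subalgebra with the restricted norm (and with the inherited ordering, $A^+=A\cap B^+$). The essential subspace is $X_{\mathrm e}=\overline{\mathrm{Span}\{\pi(a)x:a\in A,x\in X\}}=\{x\in X:\lim_\lambda\pi(e_\lambda)x=x\}$, ordered by $X_{\mathrm e}^+=X_{\mathrm e}\cap X^+$ (so that $S\subset X_{\mathrm e}^+$); $\pi_{\mathrm e}$ is the restriction of $\pi$ to $X_{\mathrm e}$. Definition (simultaneous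 power factorization). Let $A$ be a Banach algebra with left approximate identity $\{e_\lambda\}_{\lambda\in\Lambda}$ of bound $M\ge1$, $B$ a unital Banach superalgebra of $A$, $\sigma$ a continuous unital representation of $B$ on a Banach space $Y$, $T\subset Y$ non-empty, $\epsilon,\delta>0$, $0<r<(M+1)^{-1}$, $n_0\geq 1$ an integer, $\{\alpha_n\}$ a sequence in $(1,\infty)$ tending to $\infty$. A simultaneous power factorization for these data consists of $a\in A$ and maps $x_n:T\to Y$ ($n\geq 1$) such that: (1) $s=\sigma(a^n)x_n(s)$ for all $n\geq 1$, $s\in T$; (2) $\|a\|\leq M$; (3) for all $n\geq1$, $x_n$ is a uniformly continuous homeomorphism of $T$ onto $x_n(T)$, with the restricted map $\sigma(a^n):x_n(T)\to T$ as its inverse; (4) (a) $\|s-x_n(s)\|\leq\epsilon$ for $1\leq n\leq n_0$ and $s\in T$; (b) $\|x_n(s)\|\leq\alpha_n^n\max(\|s\|,\delta)$ for all $n\geq1$, $s\in T$; (5) (a) if $s_1,s_2,s_1+s_2\in T$, then $x_n(s_1+s_2)=x_n(s_1)+x_n(s_2)$ for all $n\geq 1$; (b) if $\mu\in\mathbb F$ and $s,\mu s\in T$, then $x_n(\mu s)=\mu x_n(s)$ for all $n\geq 1$; (6) there is a sequence $\{u_i\}_{i=1}^\infty$ in $\{e_\lambda:\lambda\in\Lambda\}$ such that: (a) $a=\sum_{i=1}^\infty r(1-r)^{i-1}u_i$, an element of the closed convex hull of $\{u_i:i\geq1\}$ in $A$; (b) for every $k\geq0$, $b_k=(1-r)^k1_B+\sum_{i=1}^kr(1-r)^{i-1}u_i$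 is an element of the convex hull of $\{1_B,u_1,\ldots,u_k\}$ that is invertible in $B$, $b_k^{-1}$ lies in the unital Banach subalgebra of $B$ generated by $\{u_1,\ldots,u_k\}$ (smallest closed subalgebra containing these and $1_B$), and $x_n(s)=\lim_{k\to\infty}\sigma(b_k^{-n})s$ for all $n\geq1$, $s\in T$; (c) there is a chain $\lambda_1\leq\lambda_2\leq\ldots$ in $\Lambda$ with $u_k=e_{\lambda_k}$ for all $k\geq1$, where moreover $\lambda_1<\lambda_2<\ldots$ can be required if $\Lambda$ has no largest element; (7) (a) if $T$ is bounded, so is $x_n(T)$ for all $n\geq1$; (b) if $T$ is totally bounded, so is $x_n(T)$ for all $n\geq1$; (c) $\lim_\lambda\sigma(e_\lambda)x_n(s)=x_n(s)$ uniformly on $T$ for all $n\geq1$. *)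

theory Defs
  imports "HOL-Analysis.Analysis"
begin

section \<open>Ordered Banach spaces and ordered Banach algebras over a common scalar field\<close>

text \<open>
  The scalar field is a type \<open>'f::real_normed_field\<close> and the scalar multiplication of each space is
  an explicit parameter. This covers \<open>'f = real\<close> (with \<open>scaleR\<close>) and \<open>'f = complex\<close>, and by the
  Gelfand-Mazur theorem nothing else up to isometric isomorphism. Completeness and the norm come
  from the type classes of the carrier; \<open>scale_of_real\<close> makes the type-class real
  structure the underlying one, so that real notions (cones, convex hulls) may be used directly.
\<close>

locale banach_space_over = vector_space sc
  for sc :: "'f::real_normed_field \<Rightarrow> 'v::banach \<Rightarrow> 'v" +
  assumes norm_scale: "norm (sc c v) = norm c * norm v"
    and scale_of_real: "sc (of_real t) v = t *\<^sub>R v"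

locale banach_algebra_over = banach_space_over sc
  for sc :: "'f::real_normed_field \<Rightarrow> 'a::{real_normed_algebra, banach} \<Rightarrow> 'a" +
  assumes mult_scale_left: "sc c v * w = sc c (v * w)"
    and mult_scale_right: "v * sc c w = sc c (v * w)"

locale ordered_banach_space = banach_space_over sc
  for sc :: "'f::real_normed_field \<Rightarrow> 'v::banach \<Rightarrow> 'v" +
  fixes P :: "'v set"
  assumes convex_cone_P: "convex_cone P"

locale ordered_banach_algebra = banach_algebra_over sc
  for sc :: "'f::real_normed_field \<Rightarrow> 'a::{real_normed_algebra, banach} \<Rightarrow> 'a" +
  fixes P :: "'a set"
  assumes convex_cone_P: "convex_cone P"
    and mult_P: "\<lbrakk>v \<in> P; w \<in> P\<rbrakk> \<Longrightarrow> v * w \<in> P"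

locale unital_ordered_banach_algebra = ordered_banach_algebra sc P
  for sc :: "'f::real_normed_field \<Rightarrow> 'b::{real_normed_algebra_1, banach} \<Rightarrow> 'b"
    and P :: "'b set" +
  assumes one_P: "1 \<in> P"

text \<open>
  The inclusion of \<open>A\<close> in its superalgebra \<open>B\<close> is an isometric algebra embedding \<open>\<iota>\<close>; it need
  not preserve a unit of \<open>A\<close>, should there be one.
\<close>

locale unital_ordered_banach_superalgebra =
  A: ordered_banach_algebra scaleA PA + B: unital_ordered_banach_algebra scaleB PB
  for scaleA :: "'f::real_normed_field \<Rightarrow> 'a::{real_normed_algebra, banach} \<Rightarrow> 'a"
    and PA :: "'a set"
    and scaleB :: "'f \<Rightarrow> 'b::{real_normed_algebra_1, banach} \<Rightarrow> 'b"
    and PB :: "'b set" +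
  fixes \<iota> :: "'a \<Rightarrow> 'b"
  assumes embed_add: "\<iota> (v + w) = \<iota> v + \<iota> w"
    and embed_scale: "\<iota> (scaleA c v) = scaleB c (\<iota> v)"
    and embed_mult: "\<iota> (v * w) = \<iota> v * \<iota> w"
    and norm_embed: "norm (\<iota> v) = norm v"
    and closed_range_embed: "closed (range \<iota>)"
    and embed_P: "v \<in> PA \<longleftrightarrow> \<iota> v \<in> PB"


section \<open>Invertibility and generated subalgebras\<close>

definition invertible_elem :: "'b::ring_1 \<Rightarrow> bool" where
  "invertible_elem b \<longleftrightarrow> (\<exists>c. b * c = 1 \<and> c * b = 1)"

definition inverse_elem :: "'b::ring_1 \<Rightarrow> 'b" where
  "inverse_elem b = (THE c. b * c = 1 \<and> c * b = 1)"

definition inverse_closed :: "'b::ring_1 set \<Rightarrow> bool" where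
  "inverse_closed P \<longleftrightarrow> (\<forall>b\<in>P. invertible_elem b \<longrightarrow> inverse_elem b \<in> P)"

definition closed_unital_subalgebra ::
  "('f \<Rightarrow> 'b \<Rightarrow> 'b) \<Rightarrow> 'b::real_normed_algebra_1 set \<Rightarrow> bool" where
  "closed_unital_subalgebra sc C \<longleftrightarrow>
     closed C \<and> 1 \<in> C \<and> (\<forall>v\<in>C. \<forall>w\<in>C. v + w \<in> C) \<and> (\<forall>c. \<forall>v\<in>C. sc c v \<in> C) \<and>
     (\<forall>v\<in>C. \<forall>w\<in>C. v * w \<in> C)"

definition generated_unital_subalgebra ::
  "('f \<Rightarrow> 'b \<Rightarrow> 'b) \<Rightarrow> 'b::real_normed_algebra_1 set \<Rightarrow> 'b set" where
  "generated_unital_subalgebra sc G = \<Inter>{C. closed_unital_subalgebra sc C \<and> G \<subseteq> C}"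


section \<open>Nets and approximate identities\<close>

text \<open>Nets are indexed by a directed preordered type (\<open>at_top\<close> would require a partial order).\<close>

definition net_uniform_limit ::
  "'s set \<Rightarrow> ('l::preorder \<Rightarrow> 's \<Rightarrow> 'v::real_normed_vector) \<Rightarrow> ('s \<Rightarrow> 'v) \<Rightarrow> bool" where
  "net_uniform_limit S f g \<longleftrightarrow> (\<forall>\<eta>>0. \<exists>l0. \<forall>l\<ge>l0. \<forall>s\<in>S. norm (f l s - g s) < \<eta>)"

definition net_limit :: "('l::preorder \<Rightarrow> 'v::real_normed_vector) \<Rightarrow> 'v \<Rightarrow> bool" where
  "net_limit f v \<longleftrightarrow> (\<forall>\<eta>>0. \<exists>l0. \<forall>l\<ge>l0. norm (f l - v) < \<eta>)"

definition left_approximate_identity ::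
  "('l::preorder \<Rightarrow> 'a::real_normed_algebra) \<Rightarrow> real \<Rightarrow> bool" where
  "left_approximate_identity e M \<longleftrightarrow>
     (\<forall>k l :: 'l. \<exists>m. k \<le> m \<and> l \<le> m) \<and> (\<forall>l. norm (e l) \<le> M) \<and>
     (\<forall>v. net_limit (\<lambda>l. e l * v) v)"

definition commutative_net :: "('l \<Rightarrow> 'a::times) \<Rightarrow> bool" where
  "commutative_net e \<longleftrightarrow> (\<forall>k l. e k * e l = e l * e k)"


section \<open>Representations\<close>

text \<open>
  Representations act on a closed subspace \<open>Y\<close> of a Banach space type; the values of the operators
  outside \<open>Y\<close> are irrelevant. \<open>onorm_on UNIV\<close> is the library's \<open>onorm\<close>.
\<close>

definition bounded_operator_on ::
  "('f \<Rightarrow> 'v \<Rightarrow> 'v) \<Rightarrow> 'v::real_normed_vector set \<Rightarrow> ('v \<Rightarrow> 'v) \<Rightarrow> bool" where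
  "bounded_operator_on sc Y t \<longleftrightarrow>
     t ` Y \<subseteq> Y \<and> (\<forall>y\<in>Y. \<forall>z\<in>Y. t (y + z) = t y + t z) \<and>
     (\<forall>c. \<forall>y\<in>Y. t (sc c y) = sc c (t y)) \<and> (\<exists>K. \<forall>y\<in>Y. norm (t y) \<le> K * norm y)"

definition onorm_on :: "'v::real_normed_vector set \<Rightarrow> ('v \<Rightarrow> 'v) \<Rightarrow> real" where
  "onorm_on Y t = (SUP y\<in>Y. norm (t y) / norm y)"

definition continuous_representation ::
  "('f \<Rightarrow> 'a \<Rightarrow> 'a) \<Rightarrow> ('f \<Rightarrow> 'v \<Rightarrow> 'v) \<Rightarrow> 'v::real_normed_vector set \<Rightarrow>
     ('a::real_normed_algebra \<Rightarrow> 'v \<Rightarrow> 'v) \<Rightarrow> bool" where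
  "continuous_representation scaleA scaleY Y \<pi> \<longleftrightarrow>
     (\<forall>v. bounded_operator_on scaleY Y (\<pi> v)) \<and>
     (\<forall>v w. \<forall>y\<in>Y. \<pi> (v + w) y = \<pi> v y + \<pi> w y) \<and>
     (\<forall>c v. \<forall>y\<in>Y. \<pi> (scaleA c v) y = scaleY c (\<pi> v y)) \<and>
     (\<forall>v w. \<forall>y\<in>Y. \<pi> (v * w) y = \<pi> v (\<pi> w y)) \<and>
     (\<forall>v. ((\<lambda>w. onorm_on Y (\<lambda>y. \<pi> w y - \<pi> v y)) \<longlongrightarrow> 0) (at v))"

definition unital_representation :: "'v set \<Rightarrow> ('b::one \<Rightarrow> 'v \<Rightarrow> 'v) \<Rightarrow> bool" where
  "unital_representation Y \<sigma> \<longleftrightarrow> (\<forall>y\<in>Y. \<sigma> 1 y = y)"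

definition positive_representation ::
  "'a set \<Rightarrow> 'v set \<Rightarrow> ('a \<Rightarrow> 'v \<Rightarrow> 'v) \<Rightarrow> bool" where
  "positive_representation PA PY \<pi> \<longleftrightarrow> (\<forall>v\<in>PA. \<forall>y\<in>PY. \<pi> v y \<in> PY)"

definition essential_subspace ::
  "('f::comm_ring_1 \<Rightarrow> 'v \<Rightarrow> 'v) \<Rightarrow> ('a \<Rightarrow> 'v \<Rightarrow> 'v) \<Rightarrow> 'v::real_normed_vector set" where
  "essential_subspace scaleX \<pi> = closure (module.span scaleX {\<pi> v x | v x. True})"


section \<open>Simultaneous power factorizations\<close>

text \<open>
  Powers of \<open>a \<in> A\<close> are formed in \<open>B\<close>, as \<open>\<iota> a ^ n\<close>, since the type of \<open>A\<close> carries no unit.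
  Only the values of \<open>x\<close> and \<open>u\<close> at indices at least 1, and of \<open>x n\<close> on \<open>T\<close>, matter.
  The strict order on the index preorder is \<open>k \<le> l \<and> \<not> l \<le> k\<close>.
\<close>

definition factorization_approximant ::
  "('a \<Rightarrow> 'b::real_normed_algebra_1) \<Rightarrow> real \<Rightarrow> (nat \<Rightarrow> 'a) \<Rightarrow> nat \<Rightarrow> 'b" where
  "factorization_approximant \<iota> r u k =
     (1 - r) ^ k *\<^sub>R 1 + (\<Sum>i=1..k. (r * (1 - r) ^ (i - 1)) *\<^sub>R \<iota> (u i))"

definition simultaneous_power_factorization ::
  "('f \<Rightarrow> 'b \<Rightarrow> 'b) \<Rightarrow> ('f \<Rightarrow> 'v \<Rightarrow> 'v) \<Rightarrow> 'v::banach set \<Rightarrow>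
   ('a::{real_normed_algebra, banach} \<Rightarrow> 'b::{real_normed_algebra_1, banach}) \<Rightarrow>
   ('l::preorder \<Rightarrow> 'a) \<Rightarrow> real \<Rightarrow> ('b \<Rightarrow> 'v \<Rightarrow> 'v) \<Rightarrow> 'v set \<Rightarrow>
   real \<Rightarrow> real \<Rightarrow> real \<Rightarrow> nat \<Rightarrow> (nat \<Rightarrow> real) \<Rightarrow>
   'a \<Rightarrow> (nat \<Rightarrow> 'v \<Rightarrow> 'v) \<Rightarrow> bool" where
  "simultaneous_power_factorization scaleB scaleY Y \<iota> e M \<sigma> T \<epsilon> \<delta> r n0 \<alpha> a x \<longleftrightarrow>
     (\<forall>n\<ge>1. x n ` T \<subseteq> Y) \<and>
     (\<forall>n\<ge>1. \<forall>s\<in>T. s = \<sigma> (\<iota> a ^ n) (x n s)) \<and>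
     norm a \<le> M \<and>
     (\<forall>n\<ge>1. uniformly_continuous_on T (x n) \<and>
            homeomorphism T (x n ` T) (x n) (\<sigma> (\<iota> a ^ n))) \<and>
     (\<forall>n. 1 \<le> n \<and> n \<le> n0 \<longrightarrow> (\<forall>s\<in>T. norm (s - x n s) \<le> \<epsilon>)) \<and>
     (\<forall>n\<ge>1. \<forall>s\<in>T. norm (x n s) \<le> \<alpha> n ^ n * max (norm s) \<delta>) \<and>
     (\<forall>s1\<in>T. \<forall>s2\<in>T. s1 + s2 \<in> T \<longrightarrow> (\<forall>n\<ge>1. x n (s1 + s2) = x n s1 + x n s2)) \<and>
     (\<forall>\<mu>. \<forall>s\<in>T. scaleY \<mu> s \<in> T \<longrightarrow> (\<forall>n\<ge>1. x n (scaleY \<mu> s) = scaleY \<mu> (x n s))) \<and>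
     (\<exists>(u :: nat \<Rightarrow> 'a) (lam :: nat \<Rightarrow> 'l).
        (\<lambda>i. (r * (1 - r) ^ i) *\<^sub>R u (Suc i)) sums a \<and>
        a \<in> closure (convex hull (u ` {1..})) \<and>
        (\<forall>k. factorization_approximant \<iota> r u k \<in> convex hull (insert 1 ((\<iota> \<circ> u) ` {1..k})) \<and>
             invertible_elem (factorization_approximant \<iota> r u k) \<and>
             inverse_elem (factorization_approximant \<iota> r u k)
               \<in> generated_unital_subalgebra scaleB ((\<iota> \<circ> u) ` {1..k})) \<and>
        (\<forall>n\<ge>1. \<forall>s\<in>T.
           (\<lambda>k. \<sigma> (inverse_elem (factorization_approximant \<iota> r u k) ^ n) s) \<longlonglongrightarrow> x n s) \<and>
        (\<forall>k\<ge>1. u k = e (lam k)) \<and>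
        (\<forall>k\<ge>1. lam k \<le> lam (Suc k)) \<and>
        ((\<nexists>m :: 'l. \<forall>l. l \<le> m) \<longrightarrow> (\<forall>k\<ge>1. lam k < lam (Suc k)))) \<and>
     (bounded T \<longrightarrow> (\<forall>n\<ge>1. bounded (x n ` T))) \<and>
     (totally_bounded T \<longrightarrow> (\<forall>n\<ge>1. totally_bounded (x n ` T))) \<and>
     (\<forall>n\<ge>1. net_uniform_limit T (\<lambda>l s. \<sigma> (\<iota> (e l)) (x n s)) (x n))"

end

theory Submission
  imports Defs
begin

text \<open>
  Cohen's factorization method. With \<open>b\<^sub>k\<close> the approximants, \<open>F = (1 - r) 1 + r u\<^sub>k\<^sub>+\<^sub>1\<close> and
  \<open>a\<^sub>k = b\<^sub>k - (1 - r)\<^sup>k 1\<close> one has \<open>b\<^sub>k\<^sub>+\<^sub>1 = F b\<^sub>k + r (a\<^sub>k - u\<^sub>k\<^sub>+\<^sub>1 a\<^sub>k)\<close>. Since \<open>r (M + 1) < 1\<close>, \<open>F\<close> is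
  invertible by a Neumann series, and the second term is negligible once \<open>u\<^sub>k\<^sub>+\<^sub>1\<close> is far out in the
  net. Hence all \<open>b\<^sub>k\<close> are invertible with \<open>\<parallel>b\<^sub>k\<^sup>-\<^sup>1\<parallel> \<le> L\<^sup>k\<close>, where \<open>L\<close> does not depend on the choices.
  Telescoping writes \<open>b\<^sub>k\<^sub>+\<^sub>1\<^sup>-\<^sup>n s - b\<^sub>k\<^sup>-\<^sup>n s\<close> as a sum of terms containing
  \<open>(u\<^sub>k\<^sub>+\<^sub>1 - 1) b\<^sub>k\<^sup>-\<^sup>j s\<close>, which is uniformly small on \<open>S\<close>: either \<open>S\<close> is bounded and \<open>b\<^sub>k\<^sup>-\<^sup>j\<close> is a limit
  of elements of the sum of \<open>A\<close> and the scalars, or \<open>u\<^sub>k\<^sub>+\<^sub>1\<close> commutes with \<open>b\<^sub>k\<^sup>-\<^sup>j\<close>.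
  So \<open>x\<^sub>n = lim\<^sub>k b\<^sub>k\<^sup>-\<^sup>n\<close> exists uniformly on \<open>S\<close>. Positivity is inherited: each \<open>b\<^sub>k\<close> is positive,
  so is its inverse because \<open>B\<^sup>+\<close> is inverse closed, and the cones are closed.
\<close>

section \<open>Invertible elements and closed unital subalgebras\<close>

text \<open>\<open>inverse_elem\<close> is a definite description, so it can be evaluated only once
  two-sided inverses are known to be unique: \<open>c' = c' (b c) = (c' b) c = c\<close>.\<close>

lemma inverse_elem_eqI:
  fixes b c :: "'b::ring_1"
  assumes "b * c = 1" "c * b = 1"
  shows "inverse_elem b = c" "invertible_elem b"
proof -
  have "c' = c" if "b * c' = 1 \<and> c' * b = 1" for c'
  proof -
    have "c' = c' * (b * c)" using assms by simp
    also have "\<dots> = c" using that by (simp flip: mult.assoc)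
    finally show ?thesis .
  qed
  then show "inverse_elem b = c"
    unfolding inverse_elem_def using assms by (intro the_equality) blast+
  show "invertible_elem b"
    using assms by (auto simp: invertible_elem_def)
qed

lemma power_mult_power_inverse:
  fixes b c :: "'b::ring_1"
  assumes "b * c = 1"
  shows "b ^ n * c ^ n = 1"
proof (induction n)
  case (Suc n)
  have "b ^ Suc n * c ^ Suc n = b * (b ^ n * c ^ n) * c"
    unfolding power_Suc[of b] power_Suc2[of c] by (simp only: mult.assoc)
  with Suc assms show ?case by simp
qed simp

lemma closed_unital_subalgebra_generated:
  "closed_unital_subalgebra sc (generated_unital_subalgebra sc G)"
  unfolding generated_unital_subalgebra_def closed_unital_subalgebra_def
  by (auto intro: closed_Inter)

lemma generated_unital_subalgebra_superset: "G \<subseteq> generated_unital_subalgebra sc G"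
  by (auto simp: generated_unital_subalgebra_def)

lemma generated_unital_subalgebra_subset:
  "closed_unital_subalgebra sc C \<Longrightarrow> G \<subseteq> C \<Longrightarrow> generated_unital_subalgebra sc G \<subseteq> C"
  by (auto simp: generated_unital_subalgebra_def)

lemma generated_unital_subalgebra_mono:
  "G \<subseteq> H \<Longrightarrow> generated_unital_subalgebra sc G \<subseteq> generated_unital_subalgebra sc H"
  by (auto simp: generated_unital_subalgebra_def)

context
  fixes sc :: "'f \<Rightarrow> 'b \<Rightarrow> 'b::real_normed_algebra_1" and C
  assumes C: "closed_unital_subalgebra sc C"
begin

lemma subalgebra_closed: "closed C"
  and subalgebra_one: "1 \<in> C"
  and subalgebra_add: "v \<in> C \<Longrightarrow> w \<in> C \<Longrightarrow> v + w \<in> C"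
  and subalgebra_scale: "v \<in> C \<Longrightarrow> sc c v \<in> C"
  and subalgebra_mult: "v \<in> C \<Longrightarrow> w \<in> C \<Longrightarrow> v * w \<in> C"
  using C by (auto simp: closed_unital_subalgebra_def)

lemma subalgebra_power: "v \<in> C \<Longrightarrow> v ^ n \<in> C"
  by (induction n) (auto intro: subalgebra_one subalgebra_mult)

end

section \<open>Scalar multiplication and closures of subspaces\<close>

context banach_space_over
begin

lemma bounded_linear_scale: "bounded_linear (sc c)"
proof
  show "sc c (x + y) = sc c x + sc c y" for x y
    by (rule scale_right_distrib)
  have "sc c (t *\<^sub>R x) = t *\<^sub>R sc c x" for t x
    unfolding scale_of_real[symmetric] scale_scale by (simp add: mult.commute)
  then show "sc c (t *\<^sub>R x) = t *\<^sub>R sc c x" for t x .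
  show "\<exists>K. \<forall>x. norm (sc c x) \<le> norm x * K"
    by (rule exI[of _ "norm c"]) (simp add: norm_scale mult.commute)
qed

lemma subspace_closure:
  assumes S: "subspace S"
  shows "subspace (closure S)"
proof (rule subspaceI)
  show "0 \<in> closure S"
    by (rule subsetD[OF closure_subset subspace_0[OF S]])
  show "x + y \<in> closure S" if xy: "x \<in> closure S" "y \<in> closure S" for x y
  proof -
    obtain p q where "\<And>n. p n \<in> S" "p \<longlonglongrightarrow> x" "\<And>n. q n \<in> S" "q \<longlonglongrightarrow> y"
      using xy unfolding closure_sequential by blast
    then show ?thesis unfolding closure_sequential
      by (intro exI[of _ "\<lambda>n. p n + q n"] conjI allI subspace_add[OF S] tendsto_add)
  qed
  show "sc c x \<in> closure S" if x: "x \<in> closure S" for c x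
  proof -
    obtain p where "\<And>n. p n \<in> S" "p \<longlonglongrightarrow> x"
      using x unfolding closure_sequential by blast
    then show ?thesis unfolding closure_sequential
      by (intro exI[of _ "\<lambda>n. sc c (p n)"] conjI allI subspace_scale[OF S]
          bounded_linear.tendsto[OF bounded_linear_scale])
  qed
qed

end

section \<open>Neumann series and inverses of perturbed elements\<close>

locale unital_banach_algebra_over = banach_algebra_over sc
  for sc :: "'f::real_normed_field \<Rightarrow> 'b::{real_normed_algebra_1, banach} \<Rightarrow> 'b"
begin

lemma subalgebra_scaleR:
  assumes "closed_unital_subalgebra sc C" "v \<in> C"
  shows "t *\<^sub>R v \<in> C"
  unfolding scale_of_real[symmetric] using assms by (rule subalgebra_scale)

lemma subalgebra_diff:
  assumes "closed_unital_subalgebra sc C" "v \<in> C" "w \<in> C"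
  shows "v - w \<in> C"
  using subalgebra_add[OF assms(1,2) subalgebra_scaleR[OF assms(1,3)], of "-1"] by simp

text \<open>The inverse is the sum of the geometric series, hence a limit of polynomials in
  \<open>x\<close>, which puts it in every closed unital subalgebra containing \<open>x\<close>.
  This membership is carried along in order to locate the inverses of the approximants
  later.\<close>

lemma neumann_inverse:
  fixes x :: 'b
  assumes "norm x < 1"
  obtains y where "(1 - x) * y = 1" "y * (1 - x) = 1" "norm y \<le> 1 / (1 - norm x)"
    "\<And>C. closed_unital_subalgebra sc C \<Longrightarrow> x \<in> C \<Longrightarrow> y \<in> C"
proof
  define y where "y = (\<Sum>n. x ^ n)"
  have sm: "summable (\<lambda>n. x ^ n)"
    by (rule complete_algebra_summable_geometric[OF assms])
  have sums: "(\<lambda>n. x ^ n) sums y"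
    using sm by (simp add: y_def summable_sums)
  have lim: "(\<lambda>n. \<Sum>i<n. x ^ i) \<longlonglongrightarrow> y"
    using sums by (simp add: sums_def)
  have x0: "(\<lambda>n. 1 - x ^ n) \<longlonglongrightarrow> 1"
    using tendsto_diff[OF tendsto_const[of 1] summable_LIMSEQ_zero[OF sm]] by simp
  \<comment> \<open>The partial sums telescope against \<open>1 - x\<close> from either side, and
    the remainder \<open>x ^ n\<close> tends to 0.\<close>
  have t: "(1 - x) * (\<Sum>i<n. x ^ i) = 1 - x ^ n" "(\<Sum>i<n. x ^ i) * (1 - x) = 1 - x ^ n" for n
  proof -
    have e: "(1 - x) * x ^ n = x ^ n - x ^ Suc n" "x ^ n * (1 - x) = x ^ n - x ^ Suc n" for n
      by (simp_all add: left_diff_distrib right_diff_distrib power_commutes)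
    show "(1 - x) * (\<Sum>i<n. x ^ i) = 1 - x ^ n" "(\<Sum>i<n. x ^ i) * (1 - x) = 1 - x ^ n"
      by (induction n) (simp_all add: distrib_left distrib_right e del: power_Suc)
  qed
  show "(1 - x) * y = 1"
    by (rule LIMSEQ_unique[OF tendsto_mult[OF tendsto_const lim, of "1 - x"]]) (simp add: t x0)
  show "y * (1 - x) = 1"
    by (rule LIMSEQ_unique[OF tendsto_mult[OF lim tendsto_const, of "1 - x"]]) (simp add: t x0)
  have "norm x ^ n \<ge> norm (x ^ n)" for n by (rule norm_power_ineq)
  then have "norm y \<le> (\<Sum>n. norm x ^ n)"
    unfolding y_def using assms by (intro norm_suminf_le) auto
  then show "norm y \<le> 1 / (1 - norm x)"
    using assms by (simp add: suminf_geometric)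
  fix C assume C: "closed_unital_subalgebra sc C" "x \<in> C"
  have "0 \<in> C"
    using subalgebra_scaleR[OF C(1) subalgebra_one[OF C(1)], of 0] by simp
  then have "(\<Sum>i<n. x ^ i) \<in> C" for n
    by (induction n) (simp_all add: subalgebra_add[OF C(1)] subalgebra_power[OF C])
  then show "y \<in> C"
    using closed_sequentially[OF subalgebra_closed[OF C(1)] _ lim] by blast
qed

text \<open>With \<open>F = (1 - r) 1 + r v\<close>, the perturbed element is
  \<open>F (t 1 + a) (1 - r c F\<^sup>-\<^sup>1 (v a - a))\<close>, a product of invertible elements.\<close>

lemma perturbed_inverse:
  fixes v a c :: 'b
  assumes r: "0 < r" "r * (M + 1) < 1" "norm v \<le> M"
    and b: "(t *\<^sub>R 1 + a) * c = 1" "c * (t *\<^sub>R 1 + a) = 1"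
    and small: "r * norm c * norm (v * a - a) \<le> (1 - r * (M + 1)) / 2"
  obtains c' where "((t * (1 - r)) *\<^sub>R 1 + (a + (t * r) *\<^sub>R v)) * c' = 1"
    "c' * ((t * (1 - r)) *\<^sub>R 1 + (a + (t * r) *\<^sub>R v)) = 1"
    "norm c' \<le> 2 / (1 - r * (M + 1)) * norm c"
    "\<And>C. closed_unital_subalgebra sc C \<Longrightarrow> a \<in> C \<Longrightarrow> c \<in> C \<Longrightarrow> v \<in> C \<Longrightarrow> c' \<in> C"
proof -
  \<comment> \<open>\<open>1 / q\<close> will bound the norm of the inverse of \<open>F\<close>,
    uniformly in \<open>v\<close>.\<close>
  define q where "q = 1 - r * (M + 1)"
  have q: "q > 0" using r by (simp add: q_def)
  have "M \<ge> 0" using r(3) norm_ge_zero order_trans by blast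
  with r have "r * 1 \<le> r * (M + 1)" by (intro mult_left_mono) auto
  with r have r1: "r < 1" by linarith
  \<comment> \<open>With this \<open>x\<close> one has \<open>F = (1 - r) (1 - x)\<close>, and
    \<open>r M < 1 - r\<close> makes the Neumann series for \<open>1 - x\<close> converge.\<close>
  define x where "x = - (r / (1 - r)) *\<^sub>R v"
  have nx: "norm x \<le> r * M / (1 - r)"
    using r r1 by (auto simp: x_def intro!: divide_right_mono mult_left_mono)
  also have "\<dots> < 1" using q r1 by (simp add: q_def field_simps)
  finally have nx1: "norm x < 1" .
  obtain y where y: "(1 - x) * y = 1" "y * (1 - x) = 1" "norm y \<le> 1 / (1 - norm x)"
    "\<And>C. closed_unital_subalgebra sc C \<Longrightarrow> x \<in> C \<Longrightarrow> y \<in> C"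
    using neumann_inverse[OF nx1] by blast
  define F where "F = (1 - r) *\<^sub>R 1 + r *\<^sub>R v"
  define f where "f = (1 / (1 - r)) *\<^sub>R y"
  have Fx: "F = (1 - r) *\<^sub>R (1 - x)"
    using r1 by (simp add: F_def x_def scaleR_add_right)
  have Ff: "F * f = 1" "f * F = 1"
    using y r1 by (simp_all add: Fx f_def)
  have "norm f \<le> 1 / (1 - r) * (1 / (1 - norm x))"
    unfolding f_def norm_scaleR using y(3) r1 by (intro mult_mono) auto
  also have "\<dots> \<le> 1 / (1 - r) * (1 / (1 - r * M / (1 - r)))"
    proof (intro mult_left_mono divide_left_mono)
    show "0 < (1 - norm x) * (1 - r * M / (1 - r))"
      by (rule mult_pos_pos) (use nx1 \<open>r * M / (1 - r) < 1\<close> in linarith)+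
  qed (use r1 nx in auto)
  also have "\<dots> = 1 / q"
    using r1 q by (simp add: q_def field_simps)
  finally have nf: "norm f \<le> 1 / q" .
  \<comment> \<open>Chosen so that \<open>F (t 1 + a) z = r (v a - a)\<close>. The smallness
    assumption gives norm at most 1/2, so the inverse of \<open>1 - z\<close> has norm at most
    2.\<close>
  define z where "z = r *\<^sub>R (c * f * (v * a - a))"
  have "norm z \<le> r * (norm c * (1 / q) * norm (v * a - a))"
  proof -
    have "norm (c * f * (v * a - a)) \<le> norm c * norm f * norm (v * a - a)"
      by (rule order_trans[OF norm_mult_ineq mult_right_mono[OF norm_mult_ineq norm_ge_zero]])
    also have "\<dots> \<le> norm c * (1 / q) * norm (v * a - a)"
      using nf by (intro mult_right_mono mult_left_mono) auto
    finally show ?thesis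
      unfolding z_def norm_scaleR using r(1) by (intro mult_mono) auto
  qed
  also have "\<dots> = (r * norm c * norm (v * a - a)) / q" by simp
  also have "\<dots> \<le> (q / 2) / q"
    using small q unfolding q_def by (intro divide_right_mono) auto
  also have "\<dots> = 1 / 2" using q by simp
  finally have nz: "norm z \<le> 1 / 2" .
  then obtain w where w: "(1 - z) * w = 1" "w * (1 - z) = 1" "norm w \<le> 1 / (1 - norm z)"
    "\<And>C. closed_unital_subalgebra sc C \<Longrightarrow> z \<in> C \<Longrightarrow> w \<in> C"
    using neumann_inverse[of z] by (smt (verit) field_sum_of_halves)
  have "1 / (1 - norm z) \<le> 2" using nz by (simp add: field_simps)
  with w(3) have nw: "norm w \<le> 2" by linarith
  let ?b = "t *\<^sub>R 1 + a" and ?b' = "(t * (1 - r)) *\<^sub>R 1 + (a + (t * r) *\<^sub>R v)"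
  have "F * ?b * z = r *\<^sub>R (F * (?b * c) * f * (v * a - a))"
    by (simp add: z_def mult.assoc)
  also have "\<dots> = r *\<^sub>R (v * a - a)" using b Ff by simp
  finally have "F * ?b * (1 - z) = F * ?b - r *\<^sub>R (v * a - a)"
    by (simp add: right_diff_distrib)
  also have "\<dots> = ?b'" by (simp add: F_def algebra_simps)
  finally have b': "?b' = F * ?b * (1 - z)" ..
  define c' where "c' = w * c * f"
  show ?thesis
  proof
    have "?b' * c' = F * (?b * (((1 - z) * w) * c)) * f"
      by (simp only: b' c'_def mult.assoc)
    then show "?b' * c' = 1" using w b Ff by simp
    have "c' * ?b' = w * (c * ((f * F) * ?b)) * (1 - z)"
      by (simp only: b' c'_def mult.assoc)
    then show "c' * ?b' = 1" using w b Ff by simp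
    have "norm c' \<le> norm w * norm c * norm f"
      unfolding c'_def
      by (rule order_trans[OF norm_mult_ineq mult_right_mono[OF norm_mult_ineq norm_ge_zero]])
    also have "\<dots> \<le> 2 * norm c * (1 / q)"
      using nw nf by (intro mult_mono) auto
    finally show "norm c' \<le> 2 / (1 - r * (M + 1)) * norm c" by (simp add: q_def)
    fix C assume C: "closed_unital_subalgebra sc C" "a \<in> C" "c \<in> C" "v \<in> C"
    have "x \<in> C" unfolding x_def by (rule subalgebra_scaleR[OF C(1,4)])
    then have "f \<in> C" unfolding f_def by (intro subalgebra_scaleR[OF C(1)] y(4)[OF C(1)])
    then have "z \<in> C" unfolding z_def
      by (intro subalgebra_scaleR[OF C(1)] subalgebra_mult[OF C(1)] subalgebra_diff[OF C(1)] C(2-4))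
    then show "c' \<in> C" unfolding c'_def
      using \<open>f \<in> C\<close> by (intro subalgebra_mult[OF C(1)] w(4)[OF C(1)] C(3))
  qed
qed

end


lemma (in unital_ordered_banach_algebra) power_P: "v \<in> P \<Longrightarrow> v ^ n \<in> P"
  by (induction n) (auto intro: one_P mult_P)


section \<open>Convex combinations, nets and uniform limits\<close>

text \<open>The weights sum to 1. Peeling off \<open>v 0\<close> leaves \<open>1 - r\<close> times
  the same combination for the shifted sequence, hence the induction with \<open>v\<close>
  arbitrary.\<close>

lemma convex_geometric_combination:
  fixes v :: "nat \<Rightarrow> 'a::real_vector"
  assumes C: "convex C" and r: "0 \<le> r" "r \<le> 1" and "w \<in> C" "\<And>i. i < k \<Longrightarrow> v i \<in> C"
  shows "(1 - r) ^ k *\<^sub>R w + (\<Sum>i<k. (r * (1 - r) ^ i) *\<^sub>R v i) \<in> C"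
  using assms(5)
proof (induction k arbitrary: v)
  case (Suc k)
  let ?z = "(1 - r) ^ k *\<^sub>R w + (\<Sum>i<k. (r * (1 - r) ^ i) *\<^sub>R v (Suc i))"
  have "?z \<in> C" using Suc.prems by (intro Suc.IH) auto
  then have "(1 - r) *\<^sub>R ?z + r *\<^sub>R v 0 \<in> C"
    using Suc.prems r by (intro convexD[OF C]) auto
  also have "(1 - r) *\<^sub>R ?z + r *\<^sub>R v 0
      = (1 - r) ^ Suc k *\<^sub>R w + (\<Sum>i<Suc k. (r * (1 - r) ^ i) *\<^sub>R v i)"
    unfolding sum.lessThan_Suc_shift
    by (simp add: scaleR_add_right scaleR_sum_right mult.left_commute)
  finally show ?case .
qed (simp add: assms(4))

lemma convex_cone_sum:
  assumes P: "convex_cone P" and "\<And>i. i \<in> I \<Longrightarrow> f i \<in> P"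
  shows "sum f I \<in> P"
  using assms(2)
proof (induction I rule: infinite_finite_induct)
  case (insert i I)
  then show ?case by (simp add: convex_cone_add[OF P])
qed (use P in \<open>auto simp: convex_cone_def conic_contains_0\<close>)

section \<open>Nets over a directed preorder as filters\<close>

definition net_filter :: "'l::preorder filter" where
  "net_filter = (INF k. principal {k..})"

text \<open>Directedness makes the tails a filter base, so an eventual property already holds on a
  single tail.\<close>

lemma eventually_net_filter:
  assumes "\<And>k l :: 'l::preorder. \<exists>m. k \<le> m \<and> l \<le> m"
  shows "eventually P (net_filter :: 'l filter) \<longleftrightarrow> (\<exists>k. \<forall>l\<ge>k. P l)"
proof -
  have "\<exists>m\<in>UNIV. principal {m..} \<le> inf (principal {k..}) (principal {l..})" for k l :: 'l
  proof -
    obtain m where "k \<le> m" "l \<le> m" using assms by blast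
    then have "{m..} \<subseteq> {k..} \<inter> {l..}"
      by (auto intro: order_trans[of k m] order_trans[of l m])
    then show ?thesis by auto
  qed
  then show ?thesis
    unfolding net_filter_def by (subst eventually_INF_base) (auto simp: eventually_principal)
qed

text \<open>Take \<open>l\<close> not below \<open>k\<close> and a common upper bound
  \<open>m\<close>. An \<open>n\<close> beyond \<open>m\<close> with \<open>n \<le> k\<close> would
  give \<open>l \<le> k\<close>. This supplies the strictly increasing chain of indices.\<close>

lemma eventually_net_filter_less:
  assumes directed: "\<And>k l :: 'l::preorder. \<exists>m. k \<le> m \<and> l \<le> m"
    and "\<nexists>m :: 'l. \<forall>l. l \<le> m"
  shows "eventually (\<lambda>l. k < l) (net_filter :: 'l filter)"
proof -
  obtain l where l: "\<not> l \<le> k" using assms(2) by blast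
  obtain m where "k \<le> m" "l \<le> m" using directed by blast
  then have "k < n" if "m \<le> n" for n
    using that l order_trans[of k m n] order_trans[of l m n] order_trans[of l n k]
    by (auto simp: less_le_not_le)
  then show ?thesis unfolding eventually_net_filter[OF directed] by blast
qed

lemma net_uniform_limit_iff:
  assumes "\<And>k l :: 'l::preorder. \<exists>m. k \<le> m \<and> l \<le> m"
  shows "net_uniform_limit S (f :: 'l \<Rightarrow> _) g \<longleftrightarrow> uniform_limit S f g net_filter"
  unfolding net_uniform_limit_def uniform_limit_iff eventually_net_filter[OF assms] dist_norm ..

lemma net_limit_iff:
  assumes "\<And>k l :: 'l::preorder. \<exists>m. k \<le> m \<and> l \<le> m"
  shows "net_limit (f :: 'l \<Rightarrow> _) v \<longleftrightarrow> (f \<longlongrightarrow> v) net_filter"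
  unfolding net_limit_def tendsto_iff eventually_net_filter[OF assms] dist_norm ..

section \<open>Total boundedness and uniform continuity\<close>

lemma totally_bounded_image:
  fixes f :: "'a::metric_space \<Rightarrow> 'b::metric_space"
  assumes "totally_bounded T" "uniformly_continuous_on T f"
  shows "totally_bounded (f ` T)"
  unfolding totally_bounded_metric
proof (intro allI impI)
  fix e :: real assume "e > 0"
  then obtain d where d: "d > 0" "\<And>x y. x \<in> T \<Longrightarrow> y \<in> T \<Longrightarrow> dist y x < d \<Longrightarrow> dist (f y) (f x) < e"
    using assms(2) unfolding uniformly_continuous_on_def by metis
  obtain k where k: "finite k" "T \<subseteq> (\<Union>x\<in>k. {y. dist x y < d / 2})"
    using assms(1) d(1) unfolding totally_bounded_metric by (metis half_gt_zero)
  \<comment> \<open>A centre \<open>x\<close> may lie outside \<open>T\<close>, where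
    \<open>f\<close> is not controlled; \<open>p x\<close> replaces it by a point of
    \<open>T\<close>, and halving the radius beforehand pays for the move.\<close>
  define p where "p x = (SOME y. y \<in> T \<and> dist x y < d / 2)" for x
  have "\<exists>x\<in>k. dist (f (p x)) (f y) < e" if y: "y \<in> T" for y
  proof -
    obtain x where x: "x \<in> k" "dist x y < d / 2" using subsetD[OF k(2) y] by blast
    then have p: "p x \<in> T" "dist x (p x) < d / 2"
      unfolding p_def using someI[of "\<lambda>y. y \<in> T \<and> dist x y < d / 2" y] y by auto
    have "dist (p x) y < d"
      using dist_triangle_half_r[OF p(2) x(2)] .
    then show ?thesis using d(2)[OF y p(1)] x(1) by (auto simp: dist_commute)
  qed
  then have "f ` T \<subseteq> (\<Union>x\<in>(f \<circ> p) ` k. {y. dist x y < e})" by auto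
  then show "\<exists>k. finite k \<and> f ` T \<subseteq> (\<Union>x\<in>k. {y. dist x y < e})"
    using k(1) by blast
qed

lemma uniformly_continuous_on_uniform_limit:
  fixes f :: "nat \<Rightarrow> 'a::metric_space \<Rightarrow> 'b::metric_space"
  assumes f: "\<And>n. uniformly_continuous_on T (f n)" and lim: "uniform_limit T f g sequentially"
  shows "uniformly_continuous_on T g"
  unfolding uniformly_continuous_on_def
proof (intro allI impI)
  fix e :: real assume "e > 0"
  then obtain n where n: "\<And>x. x \<in> T \<Longrightarrow> dist (f n x) (g x) < e / 3"
    using lim[unfolded uniform_limit_iff, rule_format, of "e / 3"]
    by (auto simp: eventually_sequentially)
  obtain d where d: "d > 0" "\<And>x y. x \<in> T \<Longrightarrow> y \<in> T \<Longrightarrow> dist y x < d \<Longrightarrow> dist (f n y) (f n x) < e / 3"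
    using f[of n] \<open>e > 0\<close> unfolding uniformly_continuous_on_def
    by (metis divide_pos_pos zero_less_numeral)
  have "dist (g y) (g x) < e" if "x \<in> T" "y \<in> T" "dist y x < d" for x y
    using n[OF that(1)] n[OF that(2)] d(2)[OF that]
      dist_triangle3[of "g y" "g x" "f n y"] dist_triangle[of "f n y" "g x" "f n x"] by linarith
  then show "\<exists>d>0. \<forall>x\<in>T. \<forall>y\<in>T. dist y x < d \<longrightarrow> dist (g y) (g x) < e"
    using d(1) by blast
qed


section \<open>Representations of a superalgebra\<close>

text \<open>Continuity at 0 bounds the operators on a small ball of the algebra, and homogeneity
  extends the bound to all elements.\<close>

lemma continuous_representation_bound:
  fixes \<sigma> :: "'b::{real_normed_algebra_1,banach} \<Rightarrow> 'v::banach \<Rightarrow> 'v"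
    and scaleB :: "'f::real_normed_field \<Rightarrow> 'b \<Rightarrow> 'b"
  assumes "banach_space_over scaleB" "banach_space_over scaleY"
    and "continuous_representation scaleB scaleY Y \<sigma>"
  obtains K where "K \<ge> 1" "\<And>b y. y \<in> Y \<Longrightarrow> norm (\<sigma> b y) \<le> K * norm b * norm y"
proof -
  interpret B: banach_space_over scaleB by fact
  interpret Y: banach_space_over scaleY by fact
  note rep = assms(3)[unfolded continuous_representation_def bounded_operator_on_def]
  have add: "\<sigma> (v + w) y = \<sigma> v y + \<sigma> w y" if "y \<in> Y" for v w y
    using rep that by blast
  have scale: "\<sigma> (t *\<^sub>R v) y = t *\<^sub>R \<sigma> v y" if "y \<in> Y" for t v y
    using rep that B.scale_of_real Y.scale_of_real by metis
  have zero: "\<sigma> 0 y = 0" if "y \<in> Y" for y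
    using scale[OF that, of 0 0] by simp
  \<comment> \<open>\<open>onorm_on\<close> is a supremum of reals and dominates the quotients only
    if these are bounded above, which boundedness of each operator ensures.\<close>
  have bdd: "bdd_above ((\<lambda>y. norm (\<sigma> w y - \<sigma> 0 y) / norm y) ` Y)" for w
  proof -
    have "\<exists>K. \<forall>y\<in>Y. norm (\<sigma> w y) \<le> K * norm y" using rep by simp
    then obtain K where K: "\<And>y. y \<in> Y \<Longrightarrow> norm (\<sigma> w y) \<le> K * norm y" by blast
    have "norm (\<sigma> w y - \<sigma> 0 y) / norm y \<le> \<bar>K\<bar>" if "y \<in> Y" for y
      using K[OF that] zero[OF that] mult_right_mono[OF abs_ge_self[of K] norm_ge_zero[of y]]
      by (auto simp: divide_le_eq)
    then show ?thesis by (rule bdd_aboveI2)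
  qed
  have "((\<lambda>w. onorm_on Y (\<lambda>y. \<sigma> w y - \<sigma> 0 y)) \<longlongrightarrow> 0) (at 0)"
    using rep by blast
  from LIM_D[OF this, of 1] obtain d where d: "d > 0"
    "\<forall>w. w \<noteq> 0 \<and> norm w < d \<longrightarrow> norm (onorm_on Y (\<lambda>y. \<sigma> w y - \<sigma> 0 y)) < 1"
    by auto
  have unit: "norm (\<sigma> w y) \<le> norm y" if "w \<noteq> 0" "norm w < d" "y \<in> Y" for w y
  proof (cases "y = 0")
    case True
    have "\<exists>K. norm (\<sigma> w y) \<le> K * norm y" using rep that(3) by blast
    with True show ?thesis by simp
  next
    case False
    have "norm (\<sigma> w y - \<sigma> 0 y) / norm y \<le> onorm_on Y (\<lambda>y. \<sigma> w y - \<sigma> 0 y)"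
      unfolding onorm_on_def by (rule cSUP_upper[OF that(3) bdd])
    also have "\<dots> \<le> 1" using d(2)[rule_format, of w] that(1,2) by simp
    finally show ?thesis using False by (simp add: zero[OF that(3)] divide_le_eq)
  qed
  show thesis
  proof
    show "1 \<le> max 1 (2 / d)" by simp
    fix b y assume y: "y \<in> Y"
    show "norm (\<sigma> b y) \<le> max 1 (2 / d) * norm b * norm y"
    proof (cases "b = 0")
      case False
      \<comment> \<open>Scales \<open>b\<close> to norm \<open>d / 2\<close>, inside the ball to
        which \<open>unit\<close> applies.\<close>
      define t where "t = d / (2 * norm b)"
      have t: "t > 0" using False d by (simp add: t_def)
      have "norm (\<sigma> (t *\<^sub>R b) y) \<le> norm y"
        using False d t by (intro unit y) (auto simp: t_def)
      then have "t * norm (\<sigma> b y) \<le> norm y" using t by (simp add: scale[OF y])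
      then have "norm (\<sigma> b y) \<le> 2 / d * norm b * norm y"
        using False d by (simp add: t_def field_simps)
      also have "\<dots> \<le> max 1 (2 / d) * norm b * norm y"
        by (intro mult_right_mono) auto
      finally show ?thesis .
    qed (simp add: zero[OF y])
  qed
qed

text \<open>\<open>Y\<close> and \<open>T\<close> stand for the essential subspace and
  \<open>S\<close>. A bound \<open>K\<close> of the representation is fixed as a parameter so that
  all estimates share it.\<close>

locale superalgebra_representation =
  unital_ordered_banach_superalgebra scaleA PA scaleB PB \<iota> + Y: banach_space_over scaleY
  for scaleA :: "'f::real_normed_field \<Rightarrow> 'a::{real_normed_algebra, banach} \<Rightarrow> 'a"
    and PA :: "'a set"
    and scaleB :: "'f \<Rightarrow> 'b::{real_normed_algebra_1, banach} \<Rightarrow> 'b"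
    and PB :: "'b set"
    and \<iota> :: "'a \<Rightarrow> 'b"
    and scaleY :: "'f \<Rightarrow> 'v::banach \<Rightarrow> 'v" +
  fixes Y :: "'v set" and \<sigma> :: "'b \<Rightarrow> 'v \<Rightarrow> 'v" and K :: real
    and e :: "'l::preorder \<Rightarrow> 'a" and M :: real and T :: "'v set"
  assumes Y: "Y.subspace Y" "closed Y"
    and \<sigma>: "continuous_representation scaleB scaleY Y \<sigma>" "unital_representation Y \<sigma>"
    and K: "K \<ge> 1" "\<And>b y. y \<in> Y \<Longrightarrow> norm (\<sigma> b y) \<le> K * norm b * norm y"
    and e: "left_approximate_identity e M" "M \<ge> 1"
    and T: "T \<subseteq> Y" "net_uniform_limit T (\<lambda>l s. \<sigma> (\<iota> (e l)) s) (\<lambda>s. s)"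
    and T_or_e: "bounded T \<or> commutative_net e"
begin

sublocale B: unital_banach_algebra_over scaleB ..

lemma directed:
  fixes k l :: 'l
  shows "\<exists>m. k \<le> m \<and> l \<le> m"
  using e by (auto simp: left_approximate_identity_def)

lemma norm_e: "norm (e l) \<le> M"
  and e_tendsto: "((\<lambda>l. e l * v) \<longlongrightarrow> v) net_filter"
  using e by (auto simp: left_approximate_identity_def net_limit_iff[OF directed])

lemma embed_scaleR: "\<iota> (t *\<^sub>R v) = t *\<^sub>R \<iota> v"
  by (simp only: A.scale_of_real[symmetric] B.scale_of_real[symmetric] embed_scale)

lemma bounded_linear_embed: "bounded_linear \<iota>"
  by (rule bounded_linear_intro[of _ 1]) (simp_all add: embed_add embed_scaleR norm_embed)

lemmas embed_diff = linear_diff[OF bounded_linear.linear[OF bounded_linear_embed]]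
  and embed_sum = linear_sum[OF bounded_linear.linear[OF bounded_linear_embed]]

lemma Y_scale: "y \<in> Y \<Longrightarrow> scaleY c y \<in> Y"
  and Y_diff: "y \<in> Y \<Longrightarrow> z \<in> Y \<Longrightarrow> y - z \<in> Y"
  using Y(1) by (auto intro: Y.subspace_scale Y.subspace_diff)

lemma T_in_Y: "s \<in> T \<Longrightarrow> s \<in> Y"
  using T by blast

lemma rep_closed: "y \<in> Y \<Longrightarrow> \<sigma> b y \<in> Y"
  using \<sigma> by (simp add: continuous_representation_def bounded_operator_on_def image_subset_iff)

lemma rep_add: "y \<in> Y \<Longrightarrow> z \<in> Y \<Longrightarrow> \<sigma> b (y + z) = \<sigma> b y + \<sigma> b z"
  and rep_scale: "y \<in> Y \<Longrightarrow> \<sigma> b (scaleY c y) = scaleY c (\<sigma> b y)"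
  and add_rep: "y \<in> Y \<Longrightarrow> \<sigma> (b + b') y = \<sigma> b y + \<sigma> b' y"
  and scale_rep: "y \<in> Y \<Longrightarrow> \<sigma> (scaleB c b) y = scaleY c (\<sigma> b y)"
  and rep_mult: "y \<in> Y \<Longrightarrow> \<sigma> (b * b') y = \<sigma> b (\<sigma> b' y)"
  and rep_one: "y \<in> Y \<Longrightarrow> \<sigma> 1 y = y"
  using \<sigma> by (auto simp: continuous_representation_def bounded_operator_on_def unital_representation_def)

lemma rep_diff: "y \<in> Y \<Longrightarrow> z \<in> Y \<Longrightarrow> \<sigma> b (y - z) = \<sigma> b y - \<sigma> b z"
  using rep_add[of "y - z" z b] by (simp add: Y_diff eq_diff_eq)

lemma diff_rep: "y \<in> Y \<Longrightarrow> \<sigma> (b - b') y = \<sigma> b y - \<sigma> b' y"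
  using add_rep[of y "b - b'" b'] by (simp add: eq_diff_eq)

lemma scaleR_rep: "y \<in> Y \<Longrightarrow> \<sigma> (t *\<^sub>R b) y = t *\<^sub>R \<sigma> b y"
  by (simp only: B.scale_of_real[symmetric] Y.scale_of_real[symmetric] scale_rep)

lemma norm_rep_e: "y \<in> Y \<Longrightarrow> norm (\<sigma> (\<iota> (e l)) y) \<le> K * M * norm y"
proof -
  assume y: "y \<in> Y"
  have "K * norm (\<iota> (e l)) * norm y \<le> K * M * norm y"
    using K norm_e[of l] by (intro mult_right_mono mult_left_mono) (auto simp: norm_embed)
  with K(2)[OF y, of "\<iota> (e l)"] show ?thesis by linarith
qed

section \<open>Maps on which the approximate identity acts uniformly\<close>

definition acts_uniformly :: "('v \<Rightarrow> 'v) \<Rightarrow> bool" where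
  "acts_uniformly g \<longleftrightarrow> g ` T \<subseteq> Y \<and> uniform_limit T (\<lambda>l s. \<sigma> (\<iota> (e l)) (g s)) g net_filter"

text \<open>The operators \<open>\<sigma> (\<iota> (e l))\<close> have the common bound
  \<open>K M\<close>, so the property survives uniform approximation on \<open>T\<close>. In this
  way it passes from the inverses of the approximants to their limits \<open>x n\<close>.\<close>

lemma acts_uniformly_limit:
  assumes h: "h ` T \<subseteq> Y"
    and approx: "\<And>\<eta>. \<eta> > 0 \<Longrightarrow> \<exists>g. acts_uniformly g \<and> (\<forall>s\<in>T. norm (g s - h s) \<le> \<eta>)"
  shows "acts_uniformly h"
  unfolding acts_uniformly_def uniform_limit_iff
proof (intro conjI h allI impI)
  fix \<eta> :: real assume \<eta>: "\<eta> > 0"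
  \<comment> \<open>Replacing \<open>h\<close> by \<open>g\<close> on both sides costs
    \<open>(K M + 1) \<theta> = \<eta> / 2\<close>; the other half is left for \<open>g\<close>
    itself.\<close>
  define \<theta> where "\<theta> = \<eta> / (2 * (K * M + 1))"
  have "K * M \<ge> 1" using K e(2) mult_mono[of 1 K 1 M] by simp
  then have \<theta>: "\<theta> > 0" using \<eta> by (simp add: \<theta>_def)
  have "K * M * \<theta> + \<theta> = (K * M + 1) * \<theta>" by (simp add: distrib_right)
  also have "\<dots> = \<eta> / 2"
    using nonzero_mult_div_cancel_left[of "K * M + 1" "\<eta> / 2"] \<open>K * M \<ge> 1\<close>
    by (simp add: \<theta>_def mult.commute)
  finally have \<theta>2: "K * M * \<theta> + \<theta> = \<eta> / 2" .
  obtain g where g: "acts_uniformly g" "\<And>s. s \<in> T \<Longrightarrow> norm (g s - h s) \<le> \<theta>"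
    using approx[OF \<theta>] by blast
  have "\<forall>\<^sub>F l in net_filter. \<forall>s\<in>T. dist (\<sigma> (\<iota> (e l)) (g s)) (g s) < \<eta> / 2"
    using g(1) \<eta> unfolding acts_uniformly_def uniform_limit_iff by (meson half_gt_zero)
  then show "\<forall>\<^sub>F l in net_filter. \<forall>s\<in>T. dist (\<sigma> (\<iota> (e l)) (h s)) (h s) < \<eta>"
  proof (rule eventually_mono, intro ballI)
    fix l s assume l: "\<forall>s\<in>T. dist (\<sigma> (\<iota> (e l)) (g s)) (g s) < \<eta> / 2" and s: "s \<in> T"
    have gY: "g s \<in> Y" and hY: "h s \<in> Y" using g(1) h s by (auto simp: acts_uniformly_def)
    have "dist (\<sigma> (\<iota> (e l)) (h s)) (h s) \<le> norm (\<sigma> (\<iota> (e l)) (g s - h s))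
        + dist (\<sigma> (\<iota> (e l)) (g s)) (g s) + norm (g s - h s)"
      using gY hY norm_triangle_ineq4[of "\<sigma> (\<iota> (e l)) (g s) - g s + (g s - h s)" "\<sigma> (\<iota> (e l)) (g s - h s)"]
        norm_triangle_ineq[of "\<sigma> (\<iota> (e l)) (g s) - g s" "g s - h s"]
      by (simp add: dist_norm rep_diff)
    also have "norm (\<sigma> (\<iota> (e l)) (g s - h s)) \<le> K * M * \<theta>"
      using norm_rep_e[OF Y_diff[OF gY hY], of l] mult_left_mono[OF g(2)[OF s], of "K * M"] \<open>K * M \<ge> 1\<close>
      by linarith
    finally show "dist (\<sigma> (\<iota> (e l)) (h s)) (h s) < \<eta>"
      using bspec[OF l s] g(2)[OF s] \<theta>2 by linarith
  qed
qed

text \<open>Adjoining the scalars to the range of \<open>\<iota>\<close> gives a unital subalgebra,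
  and continuity carries the operations to its closure. Elements of the algebra generated by the net
  are therefore limits of \<open>scaleB c 1 + \<iota> v\<close>.\<close>

lemma closed_unital_subalgebra_closure_adjoin_one:
  "closed_unital_subalgebra scaleB (closure {scaleB c 1 + \<iota> v | c v. True})" (is "closed_unital_subalgebra _ (closure ?D)")
proof -
  have add: "x + y \<in> ?D" if xy: "x \<in> ?D" "y \<in> ?D" for x y
  proof -
    obtain c v d w where *: "x = scaleB c 1 + \<iota> v" "y = scaleB d 1 + \<iota> w" using xy by blast
    have "x + y = scaleB (c + d) 1 + \<iota> (v + w)"
      unfolding * by (simp add: B.scale_left_distrib embed_add)
    then show ?thesis by blast
  qed
  have scale: "scaleB k x \<in> ?D" if x: "x \<in> ?D" for x k
  proof -
    obtain c v where *: "x = scaleB c 1 + \<iota> v" using x by blast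
    have "scaleB k x = scaleB (k * c) 1 + \<iota> (scaleA k v)"
      unfolding * by (simp add: B.scale_right_distrib embed_scale)
    then show ?thesis by blast
  qed
  have mult: "x * y \<in> ?D" if xy: "x \<in> ?D" "y \<in> ?D" for x y
  proof -
    obtain c v d w where *: "x = scaleB c 1 + \<iota> v" "y = scaleB d 1 + \<iota> w" using xy by blast
    have "x * y = scaleB (c * d) 1 + \<iota> (scaleA c w + scaleA d v + v * w)"
      unfolding * by (simp add: embed_add embed_scale embed_mult B.mult_scale_left B.mult_scale_right
          distrib_left distrib_right B.scale_right_distrib)
    then show ?thesis by blast
  qed
  have "(1 :: 'b) = scaleB 1 1 + \<iota> 0"
    using linear_0[OF bounded_linear.linear[OF bounded_linear_embed]] by simp
  then have one: "1 \<in> ?D" by blast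
  \<comment> \<open>One argument for sum, product and scaling, the last viewed as a binary operation
    that ignores its second argument.\<close>
  have lim: "f x y \<in> closure ?D"
    if xy: "x \<in> closure ?D" "y \<in> closure ?D" and f: "\<And>x y. x \<in> ?D \<Longrightarrow> y \<in> ?D \<Longrightarrow> f x y \<in> ?D"
      "\<And>X Y x y. X \<longlonglongrightarrow> x \<Longrightarrow> Y \<longlonglongrightarrow> y \<Longrightarrow> (\<lambda>n. f (X n) (Y n)) \<longlonglongrightarrow> f x y" for f :: "'b \<Rightarrow> 'b \<Rightarrow> 'b" and x y
  proof -
    obtain X Z where "\<And>n. X n \<in> ?D" "X \<longlonglongrightarrow> x" "\<And>n. Z n \<in> ?D" "Z \<longlonglongrightarrow> y"
      using xy unfolding closure_sequential by blast
    then show ?thesis unfolding closure_sequential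
      by (intro exI[of _ "\<lambda>n. f (X n) (Z n)"] conjI allI f)
  qed
  show ?thesis
    unfolding closed_unital_subalgebra_def
  proof (intro conjI ballI allI)
    show "1 \<in> closure ?D" by (rule subsetD[OF closure_subset one])
    fix x assume x: "x \<in> closure ?D"
    show "scaleB c x \<in> closure ?D" for c
      by (rule lim[OF x x, of "\<lambda>x y. scaleB c x"])
         (rule scale bounded_linear.tendsto[OF B.bounded_linear_scale], assumption)+
    fix y assume y: "y \<in> closure ?D"
    show "x + y \<in> closure ?D" by (rule lim[OF x y add tendsto_add])
    show "x * y \<in> closure ?D" by (rule lim[OF x y mult tendsto_mult])
  qed (rule closed_closure)
qed

text \<open>The only place where \<open>T\<close> has to be bounded or \<open>e\<close> commutative.\<close>

lemma acts_uniformly_generated: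
  assumes b: "b \<in> generated_unital_subalgebra scaleB (\<iota> ` range e)"
  shows "acts_uniformly (\<sigma> b)"
proof -
  have lim_T: "uniform_limit T (\<lambda>l s. \<sigma> (\<iota> (e l)) s) (\<lambda>s. s) net_filter"
    using T(2) by (simp add: net_uniform_limit_iff[OF directed])
  have im: "\<sigma> b ` T \<subseteq> Y" for b
    using T(1) rep_closed by auto
  consider "commutative_net e" | "bounded T" using T_or_e by blast
  then show ?thesis
  proof cases
    case 1
    \<comment> \<open>The commutant of the net is a closed unital subalgebra containing the net,
      hence also \<open>b\<close>.\<close>
    let ?C = "{b. \<forall>l. \<iota> (e l) * b = b * \<iota> (e l)}"
    have "closed ?C"
      by (intro closed_Collect_all closed_Collect_eq continuous_intros)
    then have "closed_unital_subalgebra scaleB ?C"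
      unfolding closed_unital_subalgebra_def
      by (auto simp: distrib_left distrib_right B.mult_scale_left B.mult_scale_right)
         (metis mult.assoc)
    moreover have "\<iota> ` range e \<subseteq> ?C"
      using 1 by (auto simp: commutative_net_def simp flip: embed_mult)
    ultimately have comm: "\<iota> (e l) * b = b * \<iota> (e l)" for l
      using generated_unital_subalgebra_subset b by blast
    show ?thesis
      unfolding acts_uniformly_def uniform_limit_iff
    proof (intro conjI im allI impI)
      fix \<eta> :: real assume \<eta>: "\<eta> > 0"
      define \<theta> where "\<theta> = \<eta> / (K * norm b + 1)"
      have "K * norm b \<ge> 0" using K by simp
      then have \<theta>: "\<theta> > 0" "K * norm b * \<theta> < \<eta>"
        using \<eta> by (auto simp: \<theta>_def field_simps)
      have "\<forall>\<^sub>F l in net_filter. \<forall>s\<in>T. dist (\<sigma> (\<iota> (e l)) s) s < \<theta>"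
        using lim_T \<theta> by (simp add: uniform_limit_iff)
      then show "\<forall>\<^sub>F l in net_filter. \<forall>s\<in>T. dist (\<sigma> (\<iota> (e l)) (\<sigma> b s)) (\<sigma> b s) < \<eta>"
      proof (rule eventually_mono, intro ballI)
        fix l s assume l: "\<forall>s\<in>T. dist (\<sigma> (\<iota> (e l)) s) s < \<theta>" and s: "s \<in> T"
        note sY = T_in_Y[OF s]
        \<comment> \<open>Commutation moves \<open>\<sigma> b\<close> to the front, so uniform
          convergence on \<open>T\<close> itself suffices.\<close>
        have "\<sigma> (\<iota> (e l)) (\<sigma> b s) - \<sigma> b s = \<sigma> b (\<sigma> (\<iota> (e l)) s - s)"
          using sY by (simp add: rep_diff rep_closed comm flip: rep_mult)
        then have "dist (\<sigma> (\<iota> (e l)) (\<sigma> b s)) (\<sigma> b s) \<le> K * norm b * dist (\<sigma> (\<iota> (e l)) s) s"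
          using K(2)[OF Y_diff[OF rep_closed[OF sY] sY]] by (simp add: dist_norm)
        also have "\<dots> \<le> K * norm b * \<theta>"
          using l s \<open>K * norm b \<ge> 0\<close> by (intro mult_left_mono) (auto intro: less_imp_le)
        finally show "dist (\<sigma> (\<iota> (e l)) (\<sigma> b s)) (\<sigma> b s) < \<eta>" using \<theta> by linarith
      qed
    qed
  next
    case 2
    then obtain R where R: "R > 0" "\<And>s. s \<in> T \<Longrightarrow> norm s \<le> R"
      by (auto simp: bounded_pos)
    let ?D = "{scaleB c 1 + \<iota> v | c v. True}"
    \<comment> \<open>The scalar part converges by the assumption on \<open>T\<close>. The other
      part converges because \<open>e l * v\<close> tends to \<open>v\<close> in norm, and the bound
      \<open>R\<close> makes this uniform over \<open>T\<close>.\<close>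
    have dense: "acts_uniformly (\<sigma> p)" if p: "p \<in> ?D" for p
      unfolding acts_uniformly_def uniform_limit_iff
    proof (intro conjI im allI impI)
      obtain c v where p: "p = scaleB c 1 + \<iota> v" using p by blast
      fix \<eta> :: real assume \<eta>: "\<eta> > 0"
      define \<theta> where "\<theta> = \<eta> / (norm c + K * R)"
      have "K * R > 0" using K R by simp
      then have pos: "norm c + K * R > 0" by (simp add: add_nonneg_pos)
      then have \<theta>: "\<theta> > 0" using \<eta> by (simp add: \<theta>_def)
      have "norm c * \<theta> + K * \<theta> * R = (norm c + K * R) * \<theta>" by (simp add: algebra_simps)
      also have "\<dots> = \<eta>" using pos by (simp add: \<theta>_def)
      finally have \<theta>2: "norm c * \<theta> + K * \<theta> * R = \<eta>" .
      have "\<forall>\<^sub>F l in net_filter. \<forall>s\<in>T. dist (\<sigma> (\<iota> (e l)) s) s < \<theta>"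
        using lim_T \<theta> by (simp add: uniform_limit_iff)
      moreover have "\<forall>\<^sub>F l in net_filter. dist (e l * v) v < \<theta>"
        using e_tendsto \<theta> by (simp add: tendsto_iff)
      ultimately show "\<forall>\<^sub>F l in net_filter. \<forall>s\<in>T. dist (\<sigma> (\<iota> (e l)) (\<sigma> p s)) (\<sigma> p s) < \<eta>"
      proof (rule eventually_elim2, intro ballI)
        fix l s assume l: "\<forall>s\<in>T. dist (\<sigma> (\<iota> (e l)) s) s < \<theta>" "dist (e l * v) v < \<theta>" and s: "s \<in> T"
        note sY = T_in_Y[OF s]
        have "\<sigma> (\<iota> (e l)) (\<sigma> p s) - \<sigma> p s
            = scaleY c (\<sigma> (\<iota> (e l)) s - s) + \<sigma> (\<iota> (e l * v - v)) s"
          using sY by (simp add: p add_rep rep_add scale_rep rep_scale rep_one rep_closed Y_scale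
              Y.scale_right_diff_distrib embed_diff diff_rep embed_mult rep_mult)
        then have "dist (\<sigma> (\<iota> (e l)) (\<sigma> p s)) (\<sigma> p s)
            \<le> norm c * dist (\<sigma> (\<iota> (e l)) s) s + norm (\<sigma> (\<iota> (e l * v - v)) s)"
          unfolding dist_norm Y.norm_scale[symmetric] by (simp only: norm_triangle_ineq)
        also have "norm (\<sigma> (\<iota> (e l * v - v)) s) \<le> K * dist (e l * v) v * norm s"
          using K(2)[OF sY, of "\<iota> (e l * v - v)"] by (simp add: norm_embed dist_norm)
        also have "\<dots> \<le> K * dist (e l * v) v * R"
          using R(2)[OF s] K by (intro mult_left_mono) auto
        also have "norm c * dist (\<sigma> (\<iota> (e l)) s) s + K * dist (e l * v) v * R < norm c * \<theta> + K * \<theta> * R"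
          using l s K R by (intro add_le_less_mono mult_left_mono mult_strict_right_mono mult_strict_left_mono) auto
        finally show "dist (\<sigma> (\<iota> (e l)) (\<sigma> p s)) (\<sigma> p s) < \<eta>" using \<theta>2 by simp
      qed
    qed
    have "\<iota> v = scaleB 0 1 + \<iota> v" for v by simp
    then have "\<iota> v \<in> ?D" for v by blast
    then have "\<iota> ` range e \<subseteq> closure ?D"
      using closure_subset[of ?D] by (auto simp del: mem_Collect_eq)
    then have bD: "b \<in> closure ?D"
      using generated_unital_subalgebra_subset[OF closed_unital_subalgebra_closure_adjoin_one] b by blast
    show ?thesis
    proof (rule acts_uniformly_limit[OF im])
      fix \<eta> :: real assume \<eta>: "\<eta> > 0"
      have "\<eta> / (K * R) > 0" using K R \<eta> by simp
      then obtain p where p: "p \<in> ?D" "dist p b < \<eta> / (K * R)"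
        using bD unfolding closure_approachable by blast
      have "norm (\<sigma> p s - \<sigma> b s) \<le> \<eta>" if s: "s \<in> T" for s
      proof -
        have "norm (\<sigma> p s - \<sigma> b s) \<le> K * norm (p - b) * norm s"
          using K(2)[OF T_in_Y[OF s], of "p - b"] by (simp add: diff_rep T_in_Y[OF s])
        also have "\<dots> \<le> K * (\<eta> / (K * R)) * R"
          using p(2) R(2)[OF s] K \<eta> R(1) by (intro mult_mono) (auto simp: dist_norm)
        also have "\<dots> = \<eta>" using K R by simp
        finally show ?thesis .
      qed
      with dense[OF p(1)] show "\<exists>g. acts_uniformly g \<and> (\<forall>s\<in>T. norm (g s - \<sigma> b s) \<le> \<eta>)"
        by blast
    qed
  qed
qed

text \<open>Telescoping of \<open>c'\<^sup>n - c\<^sup>n\<close> with \<open>c' - c = - t c' (v - 1) c\<close>.\<close>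

lemma power_inverse_perturbation:
  assumes y: "y \<in> Y"
    and b: "b * c = 1" and b': "c' * b' = 1" "b' - b = t *\<^sub>R (v - 1)" "\<bar>t\<bar> \<le> 1"
    and L: "K * norm c' \<le> L" "L \<ge> 1"
    and \<theta>: "\<And>j. j \<in> {1..n} \<Longrightarrow> norm (\<sigma> v (\<sigma> (c ^ j) y) - \<sigma> (c ^ j) y) \<le> \<theta>"
    and "\<theta> \<ge> 0"
  shows "norm (\<sigma> (c' ^ n) y - \<sigma> (c ^ n) y) \<le> n * L ^ n * \<theta>"
  using \<theta>
proof (induction n)
  case (Suc n)
  \<comment> \<open>The resolvent identity \<open>c' - c = - c' (b' - b) c\<close>.\<close>
  have "c' - c = c' * (b * c) - (c' * b') * c" using b b' by simp
  also have "\<dots> = - (c' * (b' - b) * c)" by (simp add: algebra_simps)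
  finally have "c' - c = - (t *\<^sub>R (c' * (v - 1) * c))" using b' by simp
  moreover have "c' ^ Suc n - c ^ Suc n = c' * (c' ^ n - c ^ n) + (c' - c) * c ^ n"
    by (simp add: algebra_simps)
  ultimately have "c' ^ Suc n - c ^ Suc n = c' * (c' ^ n - c ^ n) - t *\<^sub>R (c' * (v - 1) * c) * c ^ n"
    by simp
  also have "\<dots> = c' * (c' ^ n - c ^ n) - t *\<^sub>R (c' * ((v - 1) * c ^ Suc n))"
    by (simp add: mult.assoc)
  finally have "\<sigma> (c' ^ Suc n) y - \<sigma> (c ^ Suc n) y
      = \<sigma> (c' * (c' ^ n - c ^ n) - t *\<^sub>R (c' * ((v - 1) * c ^ Suc n))) y"
    using y by (simp only: diff_rep[symmetric])
  also have "\<dots> = \<sigma> c' (\<sigma> (c' ^ n) y - \<sigma> (c ^ n) y)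
      - t *\<^sub>R \<sigma> c' (\<sigma> v (\<sigma> (c ^ Suc n) y) - \<sigma> (c ^ Suc n) y)"
    using y by (simp add: diff_rep scaleR_rep rep_mult rep_one rep_closed rep_diff del: power_Suc)
  also have "norm \<dots> \<le> norm (\<sigma> c' (\<sigma> (c' ^ n) y - \<sigma> (c ^ n) y))
      + \<bar>t\<bar> * norm (\<sigma> c' (\<sigma> v (\<sigma> (c ^ Suc n) y) - \<sigma> (c ^ Suc n) y))"
    unfolding norm_scaleR[symmetric] by (rule norm_triangle_ineq4)
  \<comment> \<open>The two parts are the inductive bound multiplied by \<open>L\<close> and one new
    error \<open>L \<theta>\<close>; since \<open>L \<ge> 1\<close>, the latter is at most
    \<open>L ^ Suc n * \<theta>\<close>.\<close>
  also have "\<dots> \<le> L * (n * L ^ n * \<theta>) + 1 * (L * \<theta>)"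
  proof (intro add_mono mult_mono)
    have c': "norm (\<sigma> c' z) \<le> L * norm z" if "z \<in> Y" for z
      using K(2)[OF that, of c'] mult_right_mono[OF L(1) norm_ge_zero[of z]] by linarith
    have "norm (\<sigma> (c' ^ n) y - \<sigma> (c ^ n) y) \<le> n * L ^ n * \<theta>"
      using Suc by auto
    then show "norm (\<sigma> c' (\<sigma> (c' ^ n) y - \<sigma> (c ^ n) y)) \<le> L * (n * L ^ n * \<theta>)"
      using c'[OF Y_diff[OF rep_closed[OF y] rep_closed[OF y]]] L(2)
      by (meson mult_left_mono order_trans zero_le_one)
    have "norm (\<sigma> v (\<sigma> (c ^ Suc n) y) - \<sigma> (c ^ Suc n) y) \<le> \<theta>"
      using Suc.prems[of "Suc n"] by simp
    then show "norm (\<sigma> c' (\<sigma> v (\<sigma> (c ^ Suc n) y) - \<sigma> (c ^ Suc n) y)) \<le> L * \<theta>"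
      using c'[OF Y_diff[OF rep_closed[OF rep_closed[OF y]] rep_closed[OF y]]] L(2)
      by (meson mult_left_mono order_trans zero_le_one)
  qed (use b'(3) in auto)
  also have "L * \<theta> \<le> L ^ Suc n * \<theta>"
    using L(2) \<open>\<theta> \<ge> 0\<close> self_le_power[of L "Suc n"] by (intro mult_right_mono) auto
  finally show ?case by (simp add: algebra_simps)
qed simp

end


section \<open>Construction of the factorization\<close>



lemma factorization_approximant_lessThan:
  "factorization_approximant \<iota> r u k
    = (1 - r) ^ k *\<^sub>R 1 + (\<Sum>i<k. (r * (1 - r) ^ i) *\<^sub>R \<iota> (u (Suc i)))"
  by (simp add: factorization_approximant_def sum.atLeast1_atMost_eq)

context superalgebra_representation
begin

text \<open>Separates the scalar part from the part in \<open>A\<close>, on which the approximate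
  identity acts; this is the form that the recursion handles.\<close>

lemma factorization_approximant_eq:
  "factorization_approximant \<iota> r u k
    = (1 - r) ^ k *\<^sub>R 1 + \<iota> (\<Sum>i<k. (r * (1 - r) ^ i) *\<^sub>R u (Suc i))"
  by (simp add: factorization_approximant_lessThan embed_sum embed_scaleR)

lemma rep_lipschitz: "(K * norm b)-lipschitz_on Y (\<sigma> b)"
proof (rule lipschitz_onI)
  show "dist (\<sigma> b y) (\<sigma> b z) \<le> K * norm b * dist y z" if "y \<in> Y" "z \<in> Y" for y z
    using K(2)[OF Y_diff[OF that], of b] by (simp add: dist_norm rep_diff that)
qed (use K in simp)

text \<open>Joint continuity, from \<open>\<sigma> p y - \<sigma> q z = \<sigma> (p - q) y +
  \<sigma> q (y - z)\<close>. It is needed where operator and vector vary together.\<close>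

lemma rep_tendsto:
  assumes p: "(p \<longlongrightarrow> q) F" and y: "(y \<longlongrightarrow> z) F" "\<And>k. y k \<in> Y" "z \<in> Y"
  shows "((\<lambda>k. \<sigma> (p k) (y k)) \<longlongrightarrow> \<sigma> q z) F"
proof -
  have "norm (\<sigma> (p k) (y k) - \<sigma> q z) \<le> K * norm (p k - q) * norm (y k) + K * norm q * norm (y k - z)" for k
  proof -
    have "\<sigma> (p k) (y k) - \<sigma> q z = \<sigma> (p k - q) (y k) + \<sigma> q (y k - z)"
      using y by (simp add: diff_rep rep_diff)
    then show ?thesis
      using norm_triangle_mono[OF K(2)[OF y(2)] K(2)[OF Y_diff[OF y(2,3)]]] by simp
  qed
  then have "\<forall>\<^sub>F k in F. norm (\<sigma> (p k) (y k) - \<sigma> q z)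
      \<le> K * norm (p k - q) * norm (y k) + K * norm q * norm (y k - z)"
    by (intro always_eventually) blast
  moreover have "((\<lambda>k. K * norm (p k - q) * norm (y k) + K * norm q * norm (y k - z)) \<longlongrightarrow>
      K * norm (q - q) * norm z + K * norm q * norm (z - z)) F"
    by (intro tendsto_intros p y)
  ultimately have "((\<lambda>k. \<sigma> (p k) (y k) - \<sigma> q z) \<longlongrightarrow> 0) F"
    by (auto intro: Lim_null_comparison)
  then show ?thesis by (simp add: LIM_zero_iff)
qed

text \<open>One stage of the recursion, with \<open>t\<close> in the role of
  \<open>(1 - r) ^ k\<close>. Each of the finitely many requirements on the new index holds
  eventually along the net, so they can be met at once.\<close>

lemma approximant_step:
  assumes r: "0 < r" "r * (M + 1) < 1" and t: "0 \<le> t" "t \<le> 1" and "\<eta> > 0"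
    and b: "(t *\<^sub>R 1 + \<iota> a) * c = 1" "c * (t *\<^sub>R 1 + \<iota> a) = 1"
    and c: "c \<in> generated_unital_subalgebra scaleB (\<iota> ` range e)"
  shows "\<exists>l' c'. l \<le> l' \<and> ((\<nexists>m :: 'l. \<forall>l. l \<le> m) \<longrightarrow> l < l') \<and>
    ((t * (1 - r)) *\<^sub>R 1 + \<iota> (a + (r * t) *\<^sub>R e l')) * c' = 1 \<and>
    c' * ((t * (1 - r)) *\<^sub>R 1 + \<iota> (a + (r * t) *\<^sub>R e l')) = 1 \<and>
    norm c' \<le> 2 / (1 - r * (M + 1)) * norm c \<and>
    (\<forall>C. closed_unital_subalgebra scaleB C \<longrightarrow> \<iota> a \<in> C \<longrightarrow> c \<in> C \<longrightarrow> \<iota> (e l') \<in> C \<longrightarrow> c' \<in> C) \<and>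
    (\<forall>s\<in>T. \<forall>n\<le>N. norm (\<sigma> (c' ^ n) s - \<sigma> (c ^ n) s) \<le> \<eta>)"
proof -
  define q where "q = 1 - r * (M + 1)"
  have q: "q > 0" using r by (simp add: q_def)
  have "r * 1 \<le> r * (M + 1)" using e r by (intro mult_left_mono) auto
  with r have r1: "r < 1" by linarith
  \<comment> \<open>A bound for \<open>K * norm c'\<close> that depends on \<open>c\<close> but not
    on the index still to be chosen.\<close>
  define L where "L = K * (2 / q * norm c) + 1"
  have "K * (2 / q * norm c) \<ge> 0" using K q by simp
  then have L: "L \<ge> 1" "K * (2 / q * norm c) \<le> L" by (simp_all add: L_def)
  \<comment> \<open>The total error for exponents up to \<open>N\<close> will be
    \<open>N * L ^ N * \<theta>\<close>; the added 1 keeps the denominator positive when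
    \<open>N = 0\<close>.\<close>
  define \<theta> where "\<theta> = \<eta> / (N * L ^ N + 1)"
  have NL: "N * L ^ N + 1 > 0" using L by (simp add: add_nonneg_pos)
  then have \<theta>: "\<theta> > 0" "N * L ^ N * \<theta> \<le> \<eta>"
    using \<open>\<eta> > 0\<close> by (auto simp: \<theta>_def divide_le_eq)
  \<comment> \<open>The tolerance for \<open>e l' * a - a\<close> that meets the smallness condition
    of \<open>perturbed_inverse\<close>.\<close>
  define \<rho> where "\<rho> = q / 2 / (r * norm c + 1)"
  have rc: "r * norm c + 1 > 0" using r by (simp add: add_nonneg_pos)
  then have \<rho>: "\<rho> > 0" "r * norm c * \<rho> \<le> q / 2"
    using q r by (auto simp: \<rho>_def divide_le_eq)
  have "\<forall>\<^sub>F l' in net_filter. l \<le> l'"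
    unfolding eventually_net_filter[OF directed] by blast
  moreover have "\<forall>\<^sub>F l' in net_filter. (\<nexists>m :: 'l. \<forall>l. l \<le> m) \<longrightarrow> l < l'"
  proof (cases "\<nexists>m :: 'l. \<forall>l. l \<le> m")
    case True
    then show ?thesis
      using eventually_net_filter_less[OF directed True, of l] by (simp add: eventually_mono)
  qed simp
  moreover have "\<forall>\<^sub>F l' in net_filter. dist (e l' * a) a < \<rho>"
    using e_tendsto \<rho>(1) by (rule tendstoD)
  moreover have "\<forall>\<^sub>F l' in net_filter. \<forall>j\<in>{1..N}. \<forall>s\<in>T. dist (\<sigma> (\<iota> (e l')) (\<sigma> (c ^ j) s)) (\<sigma> (c ^ j) s) < \<theta>"
  proof (rule eventually_ball_finite, simp, intro ballI)
    fix j
    have "acts_uniformly (\<sigma> (c ^ j))"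
      by (rule acts_uniformly_generated[OF subalgebra_power[OF closed_unital_subalgebra_generated c]])
    then show "\<forall>\<^sub>F l' in net_filter. \<forall>s\<in>T. dist (\<sigma> (\<iota> (e l')) (\<sigma> (c ^ j) s)) (\<sigma> (c ^ j) s) < \<theta>"
      unfolding acts_uniformly_def uniform_limit_iff using \<theta>(1) by blast
  qed
  ultimately have "\<forall>\<^sub>F l' in net_filter. l \<le> l' \<and> ((\<nexists>m :: 'l. \<forall>l. l \<le> m) \<longrightarrow> l < l') \<and> dist (e l' * a) a < \<rho> \<and>
      (\<forall>j\<in>{1..N}. \<forall>s\<in>T. dist (\<sigma> (\<iota> (e l')) (\<sigma> (c ^ j) s)) (\<sigma> (c ^ j) s) < \<theta>)"
    by (intro eventually_conj)
  then obtain l' where l': "l \<le> l'" "(\<nexists>m :: 'l. \<forall>l. l \<le> m) \<longrightarrow> l < l'" "dist (e l' * a) a < \<rho>"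
    "\<And>j s. j \<in> {1..N} \<Longrightarrow> s \<in> T \<Longrightarrow> dist (\<sigma> (\<iota> (e l')) (\<sigma> (c ^ j) s)) (\<sigma> (c ^ j) s) < \<theta>"
    unfolding eventually_net_filter[OF directed] by (meson order_refl)
  have "norm (\<iota> (e l')) \<le> M" using norm_e by (simp add: norm_embed)
  moreover have "r * norm c * norm (\<iota> (e l') * \<iota> a - \<iota> a) \<le> (1 - r * (M + 1)) / 2"
  proof -
    have "norm (\<iota> (e l') * \<iota> a - \<iota> a) = dist (e l' * a) a"
      by (simp add: dist_norm norm_embed flip: embed_mult embed_diff)
    then have "r * norm c * norm (\<iota> (e l') * \<iota> a - \<iota> a) \<le> r * norm c * \<rho>"
      using l'(3) r by (intro mult_left_mono) auto
    with \<rho>(2) show ?thesis by (simp add: q_def)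
  qed
  ultimately obtain c' where c': "((t * (1 - r)) *\<^sub>R 1 + (\<iota> a + (t * r) *\<^sub>R \<iota> (e l'))) * c' = 1"
    "c' * ((t * (1 - r)) *\<^sub>R 1 + (\<iota> a + (t * r) *\<^sub>R \<iota> (e l'))) = 1"
    "norm c' \<le> 2 / (1 - r * (M + 1)) * norm c"
    "\<And>C. closed_unital_subalgebra scaleB C \<Longrightarrow> \<iota> a \<in> C \<Longrightarrow> c \<in> C \<Longrightarrow> \<iota> (e l') \<in> C \<Longrightarrow> c' \<in> C"
    using B.perturbed_inverse[OF r _ b] by blast
  have b': "(t * (1 - r)) *\<^sub>R 1 + \<iota> (a + (r * t) *\<^sub>R e l')
      = (t * (1 - r)) *\<^sub>R 1 + (\<iota> a + (t * r) *\<^sub>R \<iota> (e l'))"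
    by (simp add: embed_add embed_scaleR mult.commute)
  have "norm (\<sigma> (c' ^ n) s - \<sigma> (c ^ n) s) \<le> \<eta>" if s: "s \<in> T" and n: "n \<le> N" for s n
  proof -
    have "norm (\<sigma> (c' ^ n) s - \<sigma> (c ^ n) s) \<le> n * L ^ n * \<theta>"
    proof (rule power_inverse_perturbation[OF T_in_Y[OF s] b(1) c'(2), of "t * r"])
      show "(t * (1 - r)) *\<^sub>R 1 + (\<iota> a + (t * r) *\<^sub>R \<iota> (e l')) - (t *\<^sub>R 1 + \<iota> a)
          = (t * r) *\<^sub>R (\<iota> (e l') - 1)"
        by (simp add: algebra_simps)
      show "\<bar>t * r\<bar> \<le> 1" using t r r1 by (simp add: mult_le_one)
      show "K * norm c' \<le> L"
        using mult_left_mono[OF c'(3), of K] K(1) L(2) by (simp add: q_def)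
      show "norm (\<sigma> (\<iota> (e l')) (\<sigma> (c ^ j) s) - \<sigma> (c ^ j) s) \<le> \<theta>" if "j \<in> {1..n}" for j
        using l'(4)[of j s] that n s by (simp add: dist_norm)
    qed (use L \<theta> in auto)
    also have "\<dots> \<le> N * L ^ N * \<theta>"
      using n L \<theta> by (intro mult_right_mono mult_mono power_increasing) auto
    finally show ?thesis using \<theta> by linarith
  qed
  then show ?thesis
    using l'(1,2) c'[folded b']
    by (intro exI[of _ l'] exI[of _ c'] conjI allI impI ballI) blast+
qed

text \<open>Dependent choice along \<open>approximant_step\<close>, with tolerances that sum to
  \<open>\<eta>\<close>. The norm bound involves only \<open>r\<close> and \<open>M\<close>, so
  \<open>N\<close> and \<open>\<eta>\<close> may be selected in view of it before the sequence is
  built.\<close>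

lemma approximants_exist:
  assumes r: "0 < r" and rM: "r * (M + 1) < 1" and "\<eta> > 0"
  obtains lam :: "nat \<Rightarrow> 'l" and c :: "nat \<Rightarrow> 'b" where
    "\<And>k. lam k \<le> lam (Suc k)" "\<And>k. (\<nexists>m :: 'l. \<forall>l. l \<le> m) \<Longrightarrow> lam k < lam (Suc k)"
    "\<And>k. factorization_approximant \<iota> r (e \<circ> lam) k * c k = 1"
    "\<And>k. c k * factorization_approximant \<iota> r (e \<circ> lam) k = 1"
    "\<And>k. norm (c k) \<le> (2 / (1 - r * (M + 1))) ^ k"
    "\<And>k. c k \<in> generated_unital_subalgebra scaleB ((\<iota> \<circ> (e \<circ> lam)) ` {1..k})"
    "\<And>k s n. s \<in> T \<Longrightarrow> n \<le> N k \<Longrightarrow> norm (\<sigma> (c (Suc k) ^ n) s - \<sigma> (c k ^ n) s) \<le> \<eta> / 2 ^ Suc k"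
proof -
  let ?L = "2 / (1 - r * (M + 1))"
  let ?G = "generated_unital_subalgebra scaleB (\<iota> ` range e)"
  have "r * 1 \<le> r * (M + 1)" using e r by (intro mult_left_mono) auto
  with rM have r1: "r < 1" by linarith
  \<comment> \<open>States are triples of the current index, the part of the approximant in
    \<open>A\<close>, and the inverse. \<open>P\<close> is the invariant and \<open>Q\<close> links
    consecutive stages. \<open>P\<close> places the inverse only in the algebra generated by the
    whole net, as the next step requires.\<close>
  define P where "P k = (\<lambda>(l :: 'l, a, c). ((1 - r) ^ k *\<^sub>R 1 + \<iota> a) * c = 1 \<and> c * ((1 - r) ^ k *\<^sub>R 1 + \<iota> a) = 1 \<and>
      norm c \<le> ?L ^ k \<and> c \<in> ?G \<and> \<iota> a \<in> ?G \<and> (k = 0 \<longrightarrow> a = 0))" for k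
  define Q where "Q k = (\<lambda>(l, a, c) (l', a', c'). l \<le> l' \<and> ((\<nexists>m :: 'l. \<forall>l. l \<le> m) \<longrightarrow> l < l') \<and>
      a' = a + (r * (1 - r) ^ k) *\<^sub>R e l' \<and>
      (\<forall>C. closed_unital_subalgebra scaleB C \<longrightarrow> \<iota> a \<in> C \<longrightarrow> c \<in> C \<longrightarrow> \<iota> (e l') \<in> C \<longrightarrow> c' \<in> C) \<and>
      (\<forall>s\<in>T. \<forall>n\<le>N k. norm (\<sigma> (c' ^ n) s - \<sigma> (c ^ n) s) \<le> \<eta> / 2 ^ Suc k))" for k
  note G = closed_unital_subalgebra_generated[of scaleB]
  have e_G: "\<iota> (e l) \<in> ?G" for l
    using generated_unital_subalgebra_superset by (rule subsetD) blast
  have zero: "\<iota> 0 = 0" by (rule linear_0[OF bounded_linear.linear[OF bounded_linear_embed]])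
  have "\<exists>f. \<forall>k. P k (f k) \<and> Q k (f k) (f (Suc k))"
  proof (rule dependent_nat_choice)
    have "(0 :: 'b) \<in> ?G"
      using B.subalgebra_scaleR[OF G subalgebra_one[OF G], of 0] by simp
    \<comment> \<open>The approximant at stage 0 is 1 and involves no \<open>u i\<close>, so the
      initial index is arbitrary.\<close>
    then have "P 0 (undefined, 0, 1)"
      by (simp add: P_def zero subalgebra_one[OF G])
    then show "\<exists>x. P 0 x" ..
  next
    fix x k assume Pk: "P k x"
    obtain l a c where x: "x = (l, a, c)" by (cases x)
    note P = Pk[unfolded P_def x prod.case]
    have t: "0 \<le> (1 - r) ^ k" "(1 - r) ^ k \<le> 1"
      using r r1 by (simp_all add: power_le_one)
    have "\<eta> / 2 ^ Suc k > 0" using \<open>\<eta> > 0\<close> by simp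
    moreover have "((1 - r) ^ k *\<^sub>R 1 + \<iota> a) * c = 1" "c * ((1 - r) ^ k *\<^sub>R 1 + \<iota> a) = 1" "c \<in> ?G"
      using P by simp_all
    ultimately have "\<exists>l' c'. l \<le> l' \<and> ((\<nexists>m :: 'l. \<forall>l. l \<le> m) \<longrightarrow> l < l') \<and>
      (((1 - r) ^ k * (1 - r)) *\<^sub>R 1 + \<iota> (a + (r * (1 - r) ^ k) *\<^sub>R e l')) * c' = 1 \<and>
      c' * (((1 - r) ^ k * (1 - r)) *\<^sub>R 1 + \<iota> (a + (r * (1 - r) ^ k) *\<^sub>R e l')) = 1 \<and>
      norm c' \<le> ?L * norm c \<and>
      (\<forall>C. closed_unital_subalgebra scaleB C \<longrightarrow> \<iota> a \<in> C \<longrightarrow> c \<in> C \<longrightarrow> \<iota> (e l') \<in> C \<longrightarrow> c' \<in> C) \<and>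
      (\<forall>s\<in>T. \<forall>n\<le>N k. norm (\<sigma> (c' ^ n) s - \<sigma> (c ^ n) s) \<le> \<eta> / 2 ^ Suc k)"
      by (rule approximant_step[OF r rM t])
    then obtain l' c' where *: "l \<le> l'" "(\<nexists>m :: 'l. \<forall>l. l \<le> m) \<longrightarrow> l < l'"
      "(((1 - r) ^ k * (1 - r)) *\<^sub>R 1 + \<iota> (a + (r * (1 - r) ^ k) *\<^sub>R e l')) * c' = 1"
      "c' * (((1 - r) ^ k * (1 - r)) *\<^sub>R 1 + \<iota> (a + (r * (1 - r) ^ k) *\<^sub>R e l')) = 1"
      "norm c' \<le> ?L * norm c"
      "\<forall>C. closed_unital_subalgebra scaleB C \<longrightarrow> \<iota> a \<in> C \<longrightarrow> c \<in> C \<longrightarrow> \<iota> (e l') \<in> C \<longrightarrow> c' \<in> C"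
      "\<forall>s\<in>T. \<forall>n\<le>N k. norm (\<sigma> (c' ^ n) s - \<sigma> (c ^ n) s) \<le> \<eta> / 2 ^ Suc k"
      by (elim exE conjE)
    have "?L * norm c \<le> ?L ^ Suc k"
      unfolding power_Suc using P rM by (intro mult_left_mono) auto
    then have "P (Suc k) (l', a + (r * (1 - r) ^ k) *\<^sub>R e l', c')"
      unfolding P_def prod.case
      using P * by (auto simp: power_Suc2 embed_add embed_scaleR simp del: power_Suc intro!: *(6)[rule_format] G e_G
          subalgebra_add[OF G] B.subalgebra_scaleR[OF G])
    moreover have "Q k x (l', a + (r * (1 - r) ^ k) *\<^sub>R e l', c')"
      unfolding Q_def x prod.case using * by (intro conjI) (assumption | rule refl)+
    ultimately show "\<exists>y. P (Suc k) y \<and> Q k x y" by blast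
  qed
  then obtain f where f: "\<And>k. P k (f k)" "\<And>k. Q k (f k) (f (Suc k))" by blast
  define lam a c where "lam k = fst (f k)" and "a k = fst (snd (f k))" and "c k = snd (snd (f k))" for k
  have f_eq: "f k = (lam k, a k, c k)" for k by (simp add: lam_def a_def c_def)
  note P = f(1)[unfolded f_eq P_def prod.case] and Q = f(2)[unfolded f_eq Q_def prod.case]
  have a: "a k = (\<Sum>i<k. (r * (1 - r) ^ i) *\<^sub>R (e \<circ> lam) (Suc i))" for k
    by (induction k) (use P[of 0] Q in auto)
  have b: "factorization_approximant \<iota> r (e \<circ> lam) k = (1 - r) ^ k *\<^sub>R 1 + \<iota> (a k)" for k
    by (simp add: factorization_approximant_eq a)
  \<comment> \<open>Sharpens the membership to the indices used so far, because \<open>Q\<close>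
    speaks of every closed unital subalgebra.\<close>
  have gen: "\<iota> (a k) \<in> generated_unital_subalgebra scaleB ((\<iota> \<circ> (e \<circ> lam)) ` {1..k}) \<and>
      c k \<in> generated_unital_subalgebra scaleB ((\<iota> \<circ> (e \<circ> lam)) ` {1..k})" for k
  proof (induction k)
    case 0
    have "c 0 = 1" "a 0 = 0" using P[of 0] by (auto simp: zero)
    then show ?case
      using B.subalgebra_scaleR[OF G subalgebra_one[OF G], of 0] by (simp add: zero subalgebra_one[OF G])
  next
    case (Suc k)
    let ?C = "generated_unital_subalgebra scaleB ((\<iota> \<circ> (e \<circ> lam)) ` {1..Suc k})"
    have "generated_unital_subalgebra scaleB ((\<iota> \<circ> (e \<circ> lam)) ` {1..k}) \<subseteq> ?C"
      by (intro generated_unital_subalgebra_mono image_mono) auto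
    with Suc have old: "\<iota> (a k) \<in> ?C" "c k \<in> ?C" by blast+
    have new: "\<iota> (e (lam (Suc k))) \<in> ?C"
      by (rule subsetD[OF generated_unital_subalgebra_superset]) (auto intro: image_eqI[of _ _ "Suc k"])
    have "c (Suc k) \<in> ?C" using Q[of k] G old new by blast
    moreover have "\<iota> (a (Suc k)) \<in> ?C"
      using Q[of k] old new
      by (auto simp: embed_add embed_scaleR intro!: subalgebra_add[OF G] B.subalgebra_scaleR[OF G])
    ultimately show ?case by blast
  qed
  show thesis
    by (rule that[of lam c]) (use P Q gen in \<open>auto simp: b\<close>)
qed

text \<open>The order of choices matters: \<open>L\<close> from \<open>r\<close> and
  \<open>M\<close>, then \<open>p\<close> and \<open>N\<close> from the growth of
  \<open>\<alpha>\<close>, then \<open>\<eta>\<close>, and only then the indices. Each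
  \<open>x n\<close> is the uniform limit of the \<open>n\<close>-th powers of the inverses.\<close>

theorem simultaneous_power_factorization_exists:
  assumes "\<epsilon> > 0" "\<delta> > 0" and r: "0 < r" "r < inverse (M + 1)"
    and \<alpha>: "\<And>n. n \<ge> 1 \<Longrightarrow> \<alpha> n > 1" "filterlim \<alpha> at_top sequentially"
  obtains a x where "simultaneous_power_factorization scaleB scaleY Y \<iota> e M \<sigma> T \<epsilon> \<delta> r n0 \<alpha> a x"
proof -
  have rM: "r * (M + 1) < 1"
    using r e by (simp add: inverse_eq_divide less_divide_eq)
  have "r * 1 \<le> r * (M + 1)" using e r by (intro mult_left_mono) auto
  with rM have r1: "r < 1" by linarith
  define L where "L = 2 / (1 - r * (M + 1))"
  have "r * (M + 1) > 0" using r e by (intro mult_pos_pos) auto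
  then have L: "L \<ge> 1" using rM by (simp add: L_def)
  have "\<exists>p. \<forall>n\<ge>p. (K + 1) * L ^ Suc k \<le> \<alpha> n" for k
    using \<alpha>(2) by (simp add: filterlim_at_top eventually_sequentially)
  then obtain p where p: "\<And>k n. p k \<le> n \<Longrightarrow> (K + 1) * L ^ Suc k \<le> \<alpha> n" by metis
  \<comment> \<open>Stage \<open>k\<close> controls the exponents \<open>n \<le> N k\<close>; larger ones satisfy \<open>\<alpha> n \<ge> (K + 1) L\<^sup>k\<^sup>+\<^sup>1\<close>,
    which leaves room for the crude bound \<open>K (L\<^sup>k\<^sup>+\<^sup>1)\<^sup>n\<close> of the next approximant.\<close>
  define N where "N k = n0 + k + (\<Sum>j\<le>k. p j)" for k
  have N_mono: "N k \<le> N m" if "k \<le> m" for k m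
    unfolding N_def using that by (intro add_mono sum_mono2) auto
  have N_ge: "n0 \<le> N k" "k \<le> N k" "p k \<le> N k" for k
    using member_le_sum[of k "{..k}" p] by (auto simp: N_def)
  \<comment> \<open>\<open>\<eta>\<close> will bound the distance of \<open>x n\<close> from the
    identity for \<open>n \<le> N 0\<close>. The bound \<open>\<epsilon>\<close> serves (4)(a), the
    finitely many numbers \<open>(\<alpha> n ^ n - 1) * \<delta>\<close> serve (4)(b) for these
    \<open>n\<close>, and \<open>\<delta>\<close> serves (4)(b) for larger \<open>n\<close>.\<close>
  define H where "H = insert \<epsilon> (insert \<delta> ((\<lambda>n. (\<alpha> n ^ n - 1) * \<delta>) ` {1..N 0}))"
  define \<eta> where "\<eta> = Min H"
  have H: "finite H" "H \<noteq> {}" by (simp_all add: H_def)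
  have "(\<alpha> n ^ n - 1) * \<delta> > 0" if "n \<ge> 1" for n
    using one_less_power[OF \<alpha>(1)[OF that], of n] that assms(2) by simp
  then have "\<eta> > 0"
    unfolding \<eta>_def Min_gr_iff[OF H] using assms(1,2) by (auto simp: H_def)
  have "\<eta> \<le> z" if "z \<in> H" for z
    unfolding \<eta>_def using that H by simp
  then have \<eta>: "\<eta> \<le> \<epsilon>" "\<eta> \<le> \<delta>" "\<And>n. n \<in> {1..N 0} \<Longrightarrow> \<eta> \<le> (\<alpha> n ^ n - 1) * \<delta>"
    unfolding H_def by blast+
  obtain lam c where lam: "\<And>k. lam k \<le> lam (Suc k)"
      "\<And>k. (\<nexists>m :: 'l. \<forall>l. l \<le> m) \<Longrightarrow> lam k < lam (Suc k)"
    and bc: "\<And>k. factorization_approximant \<iota> r (e \<circ> lam) k * c k = 1"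
      "\<And>k. c k * factorization_approximant \<iota> r (e \<circ> lam) k = 1"
    and norm_c: "\<And>k. norm (c k) \<le> L ^ k"
    and c_gen: "\<And>k. c k \<in> generated_unital_subalgebra scaleB ((\<iota> \<circ> (e \<circ> lam)) ` {1..k})"
    and c_step: "\<And>k s n. s \<in> T \<Longrightarrow> n \<le> N k \<Longrightarrow>
      norm (\<sigma> (c (Suc k) ^ n) s - \<sigma> (c k ^ n) s) \<le> \<eta> / 2 ^ Suc k"
    unfolding L_def using approximants_exist[OF r(1) rM \<open>\<eta> > 0\<close>, of N] by blast
  define u where "u = e \<circ> lam"
  define b where "b = factorization_approximant \<iota> r u"
  have bc': "b k * c k = 1" "c k * b k = 1" for k
    using bc by (simp_all add: b_def u_def)
  have "c 0 = 1" using bc'(1)[of 0] by (simp add: b_def factorization_approximant_def)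
  have inverse_b: "inverse_elem (b k) = c k" "invertible_elem (b k)" for k
    using inverse_elem_eqI[OF bc'] by auto

  \<comment> \<open>The element \<open>a\<close> as limit of the approximants\<close>
  have norm_term: "norm ((r * (1 - r) ^ i) *\<^sub>R u (Suc i)) \<le> M * (r * (1 - r) ^ i)" for i
    using norm_e[of "lam (Suc i)"] r r1 by (simp add: u_def mult_right_mono mult.commute)
  have geometric: "(\<lambda>i. M * (r * (1 - r) ^ i)) sums M"
  proof -
    have "(\<lambda>i. M * (r * (1 - r) ^ i)) sums (M * (r * (1 / (1 - (1 - r)))))"
      using r r1 by (intro sums_mult geometric_sums) auto
    with r show ?thesis by simp
  qed
  define a where "a = (\<Sum>i. (r * (1 - r) ^ i) *\<^sub>R u (Suc i))"
  have "summable (\<lambda>i. (r * (1 - r) ^ i) *\<^sub>R u (Suc i))"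
    by (rule summable_comparison_test'[OF sums_summable[OF geometric] norm_term])
  then have a_sums: "(\<lambda>i. (r * (1 - r) ^ i) *\<^sub>R u (Suc i)) sums a"
    unfolding a_def by (rule summable_sums)
  then have a_lim: "(\<lambda>k. \<Sum>i<k. (r * (1 - r) ^ i) *\<^sub>R u (Suc i)) \<longlonglongrightarrow> a"
    by (simp add: sums_def)
  have norm_a: "norm a \<le> M"
    using norm_suminf_le[OF norm_term sums_summable[OF geometric]]
    unfolding a_def sums_unique[OF geometric, symmetric] .
  have r_lim: "(\<lambda>k. (1 - r) ^ k *\<^sub>R w) \<longlonglongrightarrow> 0" for w :: "'w::real_normed_vector"
    using tendsto_scaleR[OF LIMSEQ_power_zero[of "1 - r"] tendsto_const[of w]] r r1 by simp
  have b_lim: "b \<longlonglongrightarrow> \<iota> a"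
    using tendsto_add[OF r_lim[of 1] bounded_linear.tendsto[OF bounded_linear_embed a_lim]]
    by (simp add: b_def factorization_approximant_eq[abs_def])

  \<comment> \<open>The limit maps \<open>x n\<close>\<close>
  have c_diff: "norm (\<sigma> (c m ^ n) s - \<sigma> (c k ^ n) s) \<le> \<eta> / 2 ^ k - \<eta> / 2 ^ m"
    if s: "s \<in> T" and n: "n \<le> N k" and "k \<le> m" for s n k m
    using that(3)
  proof (induction m rule: dec_induct)
    case (step m)
    have "n \<le> N m" using n N_mono step(1) order_trans by blast
    from norm_triangle_mono[OF c_step[OF s this] step.IH]
    show ?case by (simp add: algebra_simps)
  qed simp
  have half_lim: "(\<lambda>k. \<eta> / 2 ^ k) \<longlonglongrightarrow> 0"
    using tendsto_mult_right_zero[OF LIMSEQ_power_zero[of "1 / 2 :: real"], of \<eta>]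
    by (simp add: power_divide)
  define x where "x n s = lim (\<lambda>k. \<sigma> (c k ^ n) s)" for n s
  have x_lim: "(\<lambda>k. \<sigma> (c k ^ n) s) \<longlonglongrightarrow> x n s" if s: "s \<in> T" for n s
  proof -
    have "Cauchy (\<lambda>k. \<sigma> (c k ^ n) s)"
    proof (rule metric_CauchyI)
      fix z :: real assume "z > 0"
      then have "\<forall>\<^sub>F k in sequentially. \<eta> / 2 ^ k < z / 2 \<and> n \<le> k"
        using order_tendstoD(2)[OF half_lim, of "z / 2"] eventually_ge_at_top[of n]
        by (intro eventually_conj) auto
      then obtain k where k: "\<eta> / 2 ^ k < z / 2" "n \<le> k"
        by (auto simp: eventually_sequentially)
      have near: "dist (\<sigma> (c m ^ n) s) (\<sigma> (c k ^ n) s) < z / 2" if "m \<ge> k" for m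
      proof -
        have "n \<le> N k" using k(2) N_ge(2) order_trans by blast
        from c_diff[OF s this that] have "dist (\<sigma> (c m ^ n) s) (\<sigma> (c k ^ n) s) \<le> \<eta> / 2 ^ k - \<eta> / 2 ^ m"
          by (simp add: dist_norm)
        moreover have "\<eta> / 2 ^ m > 0" using \<open>\<eta> > 0\<close> by simp
        ultimately show ?thesis using k(1) by linarith
      qed
      then show "\<exists>k. \<forall>m\<ge>k. \<forall>m'\<ge>k. dist (\<sigma> (c m ^ n) s) (\<sigma> (c m' ^ n) s) < z"
        using dist_triangle_half_l by blast
    qed
    then show ?thesis
      unfolding x_def by (simp add: Cauchy_convergent_iff flip: convergent_LIMSEQ_iff)
  qed
  have x_near: "norm (x n s - \<sigma> (c k ^ n) s) \<le> \<eta> / 2 ^ k" if s: "s \<in> T" and n: "n \<le> N k" for s n k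
  proof (rule LIMSEQ_le_const2)
    show "(\<lambda>m. norm (\<sigma> (c m ^ n) s - \<sigma> (c k ^ n) s)) \<longlonglongrightarrow> norm (x n s - \<sigma> (c k ^ n) s)"
      by (intro tendsto_intros x_lim s)
    have "norm (\<sigma> (c m ^ n) s - \<sigma> (c k ^ n) s) \<le> \<eta> / 2 ^ k" if "m \<ge> k" for m
      using c_diff[OF s n that] \<open>\<eta> > 0\<close> by (smt (verit) divide_pos_pos zero_less_power)
    then show "\<exists>M. \<forall>m\<ge>M. norm (\<sigma> (c m ^ n) s - \<sigma> (c k ^ n) s) \<le> \<eta> / 2 ^ k" by blast
  qed
  have x_Y: "x n s \<in> Y" if "s \<in> T" for n s
    using closed_sequentially[OF Y(2) _ x_lim[OF that]] rep_closed T_in_Y[OF that] by blast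
  have x_near_ev: "\<forall>\<^sub>F k in sequentially. \<forall>s\<in>T. norm (\<sigma> (c k ^ n) s - x n s) < z" if "z > 0" for n z
  proof -
    have "\<forall>\<^sub>F k in sequentially. \<eta> / 2 ^ k < z \<and> n \<le> k"
      using order_tendstoD(2)[OF half_lim that] eventually_ge_at_top[of n]
      by (intro eventually_conj) auto
    then show ?thesis
    proof (rule eventually_mono, intro ballI)
      fix k s assume k: "\<eta> / 2 ^ k < z \<and> n \<le> k" and s: "s \<in> T"
      then have "n \<le> N k" using N_ge(2) order_trans by blast
      from x_near[OF s this] k show "norm (\<sigma> (c k ^ n) s - x n s) < z"
        by (simp add: norm_minus_commute)
    qed
  qed
  have x_unif: "uniform_limit T (\<lambda>k. \<sigma> (c k ^ n)) (x n) sequentially" for n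
    unfolding uniform_limit_iff dist_norm using x_near_ev by blast
  \<comment> \<open>Both factors in \<open>\<sigma> (b k ^ n) (\<sigma> (c k ^ n) s) = s\<close>
    converge, so the identity passes to the limit.\<close>
  have a_x: "\<sigma> (\<iota> a ^ n) (x n s) = s" if s: "s \<in> T" for n s
  proof (rule LIMSEQ_unique)
    show "(\<lambda>k. \<sigma> (b k ^ n) (\<sigma> (c k ^ n) s)) \<longlonglongrightarrow> \<sigma> (\<iota> a ^ n) (x n s)"
      by (intro rep_tendsto tendsto_power b_lim x_lim s rep_closed T_in_Y x_Y)
    show "(\<lambda>k. \<sigma> (b k ^ n) (\<sigma> (c k ^ n) s)) \<longlonglongrightarrow> s"
      using T_in_Y[OF s] by (simp add: power_mult_power_inverse[OF bc'(1)] rep_one flip: rep_mult)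
  qed

  \<comment> \<open>Uniform continuity and the homeomorphism property\<close>
  have x_cont: "uniformly_continuous_on T (x n)" for n
  proof (rule uniformly_continuous_on_uniform_limit[OF _ x_unif])
    show "uniformly_continuous_on T (\<sigma> (c k ^ n))" for k
      by (rule lipschitz_on_uniformly_continuous[OF lipschitz_on_subset[OF rep_lipschitz T(1)]])
  qed
  have homeo: "homeomorphism T (x n ` T) (x n) (\<sigma> (\<iota> a ^ n))" for n
    unfolding homeomorphism_def
  proof (intro conjI ballI)
    show "continuous_on T (x n)" by (rule uniformly_continuous_imp_continuous[OF x_cont])
    have "x n ` T \<subseteq> Y" using x_Y by blast
    then show "continuous_on (x n ` T) (\<sigma> (\<iota> a ^ n))"
      by (rule lipschitz_on_continuous_on[OF lipschitz_on_subset[OF rep_lipschitz]])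
    show "\<sigma> (\<iota> a ^ n) (x n s) = s" if "s \<in> T" for s by (rule a_x[OF that])
    show "x n (\<sigma> (\<iota> a ^ n) y) = y" if "y \<in> x n ` T" for y using that a_x by auto
    show "\<sigma> (\<iota> a ^ n) ` x n ` T = T" using a_x by (force simp: image_image)
  qed simp
  \<comment> \<open>Stage 0 starts from \<open>c 0 = 1\<close>, so the approximation there is by the
    identity.\<close>
  have x_near_id: "norm (x n s - s) \<le> \<eta>" if "s \<in> T" "n \<le> N 0" for n s
    using x_near[OF that] \<open>c 0 = 1\<close> by (simp add: rep_one T_in_Y[OF that(1)])

  \<comment> \<open>Growth and algebraic properties of \<open>x n\<close>\<close>
  have x_growth: "norm (x n s) \<le> \<alpha> n ^ n * max (norm s) \<delta>" if s: "s \<in> T" and n: "n \<ge> 1" for n s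
  proof (cases "n \<le> N 0")
    case True
    have "norm (x n s) \<le> norm (x n s - s) + norm s"
      using norm_triangle_ineq[of "x n s - s" s] by simp
    also have "\<dots> \<le> (\<alpha> n ^ n - 1) * \<delta> + norm s"
      using x_near_id[OF s True] \<eta>(3)[of n] True n by simp
    also have "\<dots> \<le> (\<alpha> n ^ n - 1) * max (norm s) \<delta> + max (norm s) \<delta>"
      using one_le_power[of "\<alpha> n" n] \<alpha>(1)[OF n] by (intro add_mono mult_left_mono) auto
    finally show ?thesis by (simp add: algebra_simps)
  next
    case False
    \<comment> \<open>The first stage that admits \<open>n\<close>. The stage \<open>m\<close>
      before it does not, so \<open>n > N m \<ge> p m\<close>, and hence
      \<open>\<alpha> n \<ge> (K + 1) * L ^ k\<close>.\<close>
    define k where "k = (LEAST k. n \<le> N k)"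
    have nk: "n \<le> N k" unfolding k_def by (rule LeastI[of _ n]) (rule N_ge)
    with False have "k \<noteq> 0" by (metis)
    then obtain m where m: "k = Suc m" by (cases k) auto
    have "\<not> n \<le> N m" using not_less_Least[of m "\<lambda>k. n \<le> N k"] m by (auto simp: k_def)
    then have "p m \<le> n" using N_ge(3)[of m] by linarith
    then have \<alpha>n: "(K + 1) * L ^ k \<le> \<alpha> n" using p m by blast
    have "norm (c k ^ n) \<le> (L ^ k) ^ n"
      using norm_c[of k] by (meson norm_ge_zero norm_power_ineq order_trans power_mono)
    then have "K * norm (c k ^ n) * norm s \<le> K * (L ^ k) ^ n * norm s"
      using K(1) by (intro mult_right_mono mult_left_mono) auto
    then have "norm (\<sigma> (c k ^ n) s) \<le> K * (L ^ k) ^ n * norm s"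
      using K(2)[OF T_in_Y[OF s], of "c k ^ n"] by linarith
    moreover have "norm (x n s) \<le> norm (x n s - \<sigma> (c k ^ n) s) + norm (\<sigma> (c k ^ n) s)"
      using norm_triangle_ineq[of "x n s - \<sigma> (c k ^ n) s" "\<sigma> (c k ^ n) s"] by simp
    moreover have "\<eta> / 2 ^ k \<le> \<delta>"
      using \<open>\<eta> > 0\<close> \<eta>(2) by (smt (verit) divide_le_eq_1_pos divide_right_mono div_by_1 frac_le one_le_power)
    ultimately have "norm (x n s) \<le> K * (L ^ k) ^ n * norm s + \<delta>"
      using x_near[OF s nk] by linarith
    also have "\<dots> \<le> K * (L ^ k) ^ n * max (norm s) \<delta> + (L ^ k) ^ n * max (norm s) \<delta>"
    proof (rule add_mono)
      have "1 * \<delta> \<le> (L ^ k) ^ n * max (norm s) \<delta>"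
        using L assms(2) by (intro mult_mono one_le_power) auto
      then show "\<delta> \<le> (L ^ k) ^ n * max (norm s) \<delta>" by simp
    qed (use K(1) L in \<open>auto intro!: mult_left_mono\<close>)
    also have "\<dots> = (K + 1) * (L ^ k) ^ n * max (norm s) \<delta>" by (simp add: algebra_simps)
    \<comment> \<open>Since \<open>n \<ge> 1\<close>, raising \<open>K + 1\<close> to the power
      \<open>n\<close> only enlarges it and turns the factor into the \<open>n\<close>-th power of
      \<open>(K + 1) * L ^ k\<close>.\<close>
    also have "\<dots> \<le> (K + 1) ^ n * (L ^ k) ^ n * max (norm s) \<delta>"
      using self_le_power[of "K + 1" n] K(1) n L assms(2) by (intro mult_right_mono) auto
    also have "\<dots> \<le> \<alpha> n ^ n * max (norm s) \<delta>"
      unfolding power_mult_distrib[symmetric]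
      using \<alpha>n K(1) L assms(2) by (intro mult_right_mono power_mono) auto
    finally show ?thesis .
  qed
  have x_add: "x n (s1 + s2) = x n s1 + x n s2" if s: "s1 \<in> T" "s2 \<in> T" "s1 + s2 \<in> T" for n s1 s2
    using tendsto_add[OF x_lim[OF s(1), of n] x_lim[OF s(2), of n]] x_lim[OF s(3), of n]
    by (simp add: rep_add T_in_Y s LIMSEQ_unique)
  have x_scale: "x n (scaleY \<mu> s) = scaleY \<mu> (x n s)" if s: "s \<in> T" "scaleY \<mu> s \<in> T" for n \<mu> s
    using bounded_linear.tendsto[OF Y.bounded_linear_scale x_lim[OF s(1), of n], of \<mu>] x_lim[OF s(2), of n]
    by (simp add: rep_scale T_in_Y s LIMSEQ_unique)

  \<comment> \<open>Convex hulls and the remaining clauses\<close>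
  have a_hull: "a \<in> closure (convex hull (u ` {1..}))"
  proof -
    \<comment> \<open>The weights of a partial sum add up to \<open>1 - (1 - r) ^ k\<close>; the
      missing mass is given to \<open>u 1\<close> and vanishes in the limit.\<close>
    let ?z = "\<lambda>k. (1 - r) ^ k *\<^sub>R u 1 + (\<Sum>i<k. (r * (1 - r) ^ i) *\<^sub>R u (Suc i))"
    have "?z k \<in> convex hull (u ` {1..})" for k
      using r r1 by (intro convex_geometric_combination) (auto intro: hull_inc)
    moreover have "?z \<longlonglongrightarrow> a"
      using tendsto_add[OF r_lim[of "u 1"] a_lim] by simp
    ultimately show ?thesis unfolding closure_sequential
      by (intro exI[of _ ?z] conjI allI)
  qed
  have b_hull: "b k \<in> convex hull (insert 1 ((\<iota> \<circ> u) ` {1..k}))" for k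
    unfolding b_def factorization_approximant_lessThan
    using r r1 by (intro convex_geometric_combination) (auto intro!: hull_inc)
  have x_net: "net_uniform_limit T (\<lambda>l s. \<sigma> (\<iota> (e l)) (x n s)) (x n)" for n
  proof -
    have "acts_uniformly (x n)"
    proof (rule acts_uniformly_limit)
      show "x n ` T \<subseteq> Y" using x_Y by blast
      fix z :: real assume "z > 0"
      then obtain k where k: "\<forall>s\<in>T. norm (\<sigma> (c k ^ n) s - x n s) < z"
        using x_near_ev[of z n] by (auto simp: eventually_sequentially)
      have "generated_unital_subalgebra scaleB ((\<iota> \<circ> (e \<circ> lam)) ` {1..k})
          \<subseteq> generated_unital_subalgebra scaleB (\<iota> ` range e)"
        by (rule generated_unital_subalgebra_mono) auto
      then have "c k \<in> generated_unital_subalgebra scaleB (\<iota> ` range e)"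
        using c_gen by blast
      then have "acts_uniformly (\<sigma> (c k ^ n))"
        by (intro acts_uniformly_generated subalgebra_power[OF closed_unital_subalgebra_generated])
      with k show "\<exists>g. acts_uniformly g \<and> (\<forall>s\<in>T. norm (g s - x n s) \<le> z)"
        by (meson less_imp_le)
    qed
    then show ?thesis by (simp add: acts_uniformly_def net_uniform_limit_iff[OF directed])
  qed
  have x_bounded: "bounded (x n ` T)" if T: "bounded T" and n: "n \<ge> 1" for n
  proof -
    obtain R where R: "\<And>s. s \<in> T \<Longrightarrow> norm s \<le> R" using T by (auto simp: bounded_iff)
    have "norm (x n s) \<le> \<alpha> n ^ n * max R \<delta>" if s: "s \<in> T" for s
      using R[OF s] \<alpha>(1)[OF n]
      by (intro order_trans[OF x_growth[OF s n]] mult_left_mono max.mono) auto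
    then show ?thesis by (auto simp: bounded_iff)
  qed
  have "simultaneous_power_factorization scaleB scaleY Y \<iota> e M \<sigma> T \<epsilon> \<delta> r n0 \<alpha> a x"
    unfolding simultaneous_power_factorization_def
  proof (intro conjI allI impI ballI)
    show "norm (s - x n s) \<le> \<epsilon>" if "1 \<le> n \<and> n \<le> n0" "s \<in> T" for n s
      using x_near_id[OF that(2), of n] that(1) N_ge(1)[of 0] \<eta>(1) by (simp add: norm_minus_commute)
    show "totally_bounded (x n ` T)" if "totally_bounded T" for n
      by (rule totally_bounded_image[OF that x_cont])
    show "\<exists>u' lam'. (\<lambda>i. (r * (1 - r) ^ i) *\<^sub>R u' (Suc i)) sums a \<and>
        a \<in> closure (convex hull (u' ` {1..})) \<and>
        (\<forall>k. factorization_approximant \<iota> r u' k \<in> convex hull (insert 1 ((\<iota> \<circ> u') ` {1..k})) \<and>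
             invertible_elem (factorization_approximant \<iota> r u' k) \<and>
             inverse_elem (factorization_approximant \<iota> r u' k)
               \<in> generated_unital_subalgebra scaleB ((\<iota> \<circ> u') ` {1..k})) \<and>
        (\<forall>n\<ge>1. \<forall>s\<in>T.
           (\<lambda>k. \<sigma> (inverse_elem (factorization_approximant \<iota> r u' k) ^ n) s) \<longlonglongrightarrow> x n s) \<and>
        (\<forall>k\<ge>1. u' k = e (lam' k)) \<and>
        (\<forall>k\<ge>1. lam' k \<le> lam' (Suc k)) \<and>
        ((\<nexists>m :: 'l. \<forall>l. l \<le> m) \<longrightarrow> (\<forall>k\<ge>1. lam' k < lam' (Suc k)))"
      by (rule exI[of _ u], rule exI[of _ lam], fold b_def)
         (use a_sums a_hull b_hull inverse_b c_gen x_lim lam in \<open>auto simp: u_def\<close>)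
  qed (use a_x norm_a x_cont homeo x_growth x_add x_scale x_bounded x_net x_Y in auto)
  then show thesis by (rule that)
qed

end


section \<open>Positivity\<close>

text \<open>The general existence result applies on the essential subspace. Clause (6) exhibits
  \<open>a\<close> and \<open>x n s\<close> as limits of positive elements, and the cones are
  closed.\<close>

theorem theorem5p3:
  fixes scaleA :: "'f::real_normed_field \<Rightarrow> 'a::{real_normed_algebra, banach} \<Rightarrow> 'a"
    and PA :: "'a set"
    and e :: "'l::preorder \<Rightarrow> 'a"
    and M :: real
    and scaleX :: "'f \<Rightarrow> 'x::banach \<Rightarrow> 'x"
    and PX :: "'x set"
    and \<pi> :: "'a \<Rightarrow> 'x \<Rightarrow> 'x"
    and S :: "'x set"
    and scaleB :: "'f \<Rightarrow> 'b::{real_normed_algebra_1, banach} \<Rightarrow> 'b"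
    and PB :: "'b set"
    and \<iota> :: "'a \<Rightarrow> 'b"
    and \<sigma> :: "'b \<Rightarrow> 'x \<Rightarrow> 'x"
  defines "Xe \<equiv> essential_subspace scaleX \<pi>"
  assumes A: "ordered_banach_algebra scaleA PA" "closed PA"
    and e: "left_approximate_identity e M" "M \<ge> 1" "range e \<subseteq> PA"
    and X: "ordered_banach_space scaleX PX" "closed PX"
    and \<pi>: "continuous_representation scaleA scaleX UNIV \<pi>" "positive_representation PA PX \<pi>"
    and S: "S \<noteq> {}" "S \<subseteq> PX" "net_uniform_limit S (\<lambda>l s. \<pi> (e l) s) (\<lambda>s. s)"
    and S_or_e: "bounded S \<or> commutative_net e"
    and B: "unital_ordered_banach_superalgebra scaleA PA scaleB PB \<iota>"
    and \<sigma>: "continuous_representation scaleB scaleX Xe \<sigma>" "unital_representation Xe \<sigma>"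
      "positive_representation PB (Xe \<inter> PX) \<sigma>" "\<forall>v. \<forall>y\<in>Xe. \<sigma> (\<iota> v) y = \<pi> v y"
    and inverse_closed: "inverse_closed PB"
  shows "\<forall>\<epsilon>>0. \<forall>\<delta>>0. \<forall>r n0 \<alpha>.
    0 < r \<and> r < inverse (M + 1) \<and> n0 \<ge> 1 \<and> (\<forall>n\<ge>1. \<alpha> n > 1) \<and> filterlim \<alpha> at_top sequentially \<longrightarrow>
    (\<exists>a x. simultaneous_power_factorization scaleB scaleX Xe \<iota> e M \<sigma> S \<epsilon> \<delta> r n0 \<alpha> a x \<and>
       a \<in> PA \<and> (\<forall>n\<ge>1. x n ` S \<subseteq> Xe \<inter> PX))"
proof (intro allI impI)
  fix \<epsilon> \<delta> r :: real and n0 :: nat and \<alpha> :: "nat \<Rightarrow> real"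
  assume "\<epsilon> > 0" "\<delta> > 0"
    and par: "0 < r \<and> r < inverse (M + 1) \<and> n0 \<ge> 1 \<and> (\<forall>n\<ge>1. \<alpha> n > 1) \<and> filterlim \<alpha> at_top sequentially"
  interpret X: ordered_banach_space scaleX PX by fact
  interpret AB: unital_ordered_banach_superalgebra scaleA PA scaleB PB \<iota> by fact
  have Xe: "Xe = closure (X.span {\<pi> v y | v y. True})"
    by (simp add: Xe_def essential_subspace_def)
  \<comment> \<open>Each \<open>s\<close> is a limit of vectors \<open>\<pi> (e l) s\<close>, which
    lie in the span.\<close>
  have S_Xe: "S \<subseteq> Xe"
  proof
    fix s assume s: "s \<in> S"
    have "\<exists>y\<in>X.span {\<pi> v y | v y. True}. dist y s < \<eta>" if "\<eta> > 0" for \<eta>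
    proof -
      obtain l where "norm (\<pi> (e l) s - s) < \<eta>"
        using S(3) s \<open>\<eta> > 0\<close> unfolding net_uniform_limit_def by (meson order_refl)
      moreover have "\<pi> (e l) s \<in> X.span {\<pi> v y | v y. True}"
        by (rule X.span_base) blast
      ultimately show ?thesis unfolding dist_norm by blast
    qed
    then show "s \<in> Xe" unfolding Xe closure_approachable by blast
  qed
  have \<sigma>_e: "\<sigma> (\<iota> v) s = \<pi> v s" if "s \<in> S" for v s
    using \<sigma>(4) that S_Xe by blast
  obtain K where K: "K \<ge> 1" "\<And>b y. y \<in> Xe \<Longrightarrow> norm (\<sigma> b y) \<le> K * norm b * norm y"
    using continuous_representation_bound[OF AB.B.banach_space_over_axioms X.banach_space_over_axioms \<sigma>(1)]
    by blast
  note e_PA = e(3) and positive = \<sigma>(3)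
  interpret superalgebra_representation scaleA PA scaleB PB \<iota> scaleX Xe \<sigma> K e M S
  proof
    show "X.subspace Xe"
      unfolding Xe by (intro X.subspace_closure X.subspace_span)
    show "closed Xe" by (simp add: Xe)
    show "net_uniform_limit S (\<lambda>l s. \<sigma> (\<iota> (e l)) s) (\<lambda>s. s)"
      using S(3) by (simp add: net_uniform_limit_def \<sigma>_e)
  qed (use K \<sigma> e S S_Xe S_or_e in auto)
  obtain a x where spf: "simultaneous_power_factorization scaleB scaleX Xe \<iota> e M \<sigma> S \<epsilon> \<delta> r n0 \<alpha> a x"
    using simultaneous_power_factorization_exists[OF \<open>\<epsilon> > 0\<close> \<open>\<delta> > 0\<close>, of r \<alpha> n0] par by blast
  \<comment> \<open>clause (6) of the factorization\<close>
  note spf[unfolded simultaneous_power_factorization_def, THEN conjunct2, THEN conjunct2,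
      THEN conjunct2, THEN conjunct2, THEN conjunct2, THEN conjunct2, THEN conjunct2,
      THEN conjunct2, THEN conjunct1]
  then obtain u lam where a: "(\<lambda>i. (r * (1 - r) ^ i) *\<^sub>R u (Suc i)) sums a"
    and inv: "\<And>k. invertible_elem (factorization_approximant \<iota> r u k)"
    and x: "\<And>n s. n \<ge> 1 \<Longrightarrow> s \<in> S \<Longrightarrow>
      (\<lambda>k. \<sigma> (inverse_elem (factorization_approximant \<iota> r u k) ^ n) s) \<longlonglongrightarrow> x n s"
    and u: "\<And>k. k \<ge> 1 \<Longrightarrow> u k = e (lam k)"
    by blast
  have "r \<le> 1" using par e(2) by (smt (verit) inverse_le_1_iff)
  then have coeff: "0 \<le> (1 - r) ^ i" "0 \<le> r * (1 - r) ^ i" for i using par by simp_all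
  have u_PA: "u (Suc i) \<in> PA" for i using u[of "Suc i"] e_PA by auto
  have "(\<Sum>i<k. (r * (1 - r) ^ i) *\<^sub>R u (Suc i)) \<in> PA" for k
    by (intro convex_cone_sum convex_cone_scaleR AB.A.convex_cone_P coeff u_PA)
  then have "a \<in> PA"
    by (rule closed_sequentially[OF A(2) _ a[unfolded sums_def]])
  moreover have "x n ` S \<subseteq> Xe \<inter> PX" if n: "n \<ge> 1" for n
  proof
    fix y assume "y \<in> x n ` S"
    then obtain s where s: "s \<in> S" "y = x n s" by blast
    have "factorization_approximant \<iota> r u k \<in> PB" for k
      unfolding factorization_approximant_lessThan
      by (intro convex_cone_add[OF AB.B.convex_cone_P] convex_cone_sum convex_cone_scaleR
          AB.B.convex_cone_P AB.B.one_P) (use coeff u_PA AB.embed_P in auto)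
    \<comment> \<open>Inverse closedness enters here. The powers of the inverse then stay in the
      cone, which is closed under products, and act positively on \<open>s\<close>.\<close>
    then have "inverse_elem (factorization_approximant \<iota> r u k) \<in> PB" for k
      using inverse_closed inv by (auto simp: inverse_closed_def)
    then have "\<sigma> (inverse_elem (factorization_approximant \<iota> r u k) ^ n) s \<in> Xe \<inter> PX" for k
      using positive AB.B.power_P s(1) S(2) S_Xe unfolding positive_representation_def by blast
    moreover have "closed (Xe \<inter> PX)" using X(2) by (simp add: Xe closed_Int)
    ultimately show "y \<in> Xe \<inter> PX"
      unfolding s(2) by (intro closed_sequentially[OF _ _ x[OF n s(1)]])
  qed
  ultimately show "\<exists>a x. simultaneous_power_factorization scaleB scaleX Xe \<iota> e M \<sigma> S \<epsilon> \<delta> r n0 \<alpha> a x \<and>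
      a \<in> PA \<and> (\<forall>n\<ge>1. x n ` S \<subseteq> Xe \<inter> PX)"
    using spf by blast
qed

end
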